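(* Let $F_2$ be the free group with basis $\{a,b\}$, let $\epsilon \in \mathrm{Aut}(F_2)$ be defined by $a\epsilon = a^{-1}$, $b\epsilon = b^{-1}$, and let $\varphi \in \mathrm{Aut}(F_2)$. Then the following conditions are equivalent: (i) $\varphi$ satisfies a Lipschitz condition for every visual metric $d \in V^{A'}(p',\gamma',T)$ on $F_2$, where $A'$ is a basis of $F_2$ (for every basis $A'$ and all $p'\in F_2$, $\gamma'>0$, $T\geq 1$); (ii) $\varphi \in \langle \mathrm{Inn}(F_2) \cup \{ \epsilon \} \rangle = \langle \epsilon \rangle\, \mathrm{Inn}(F_2)$.
   Context: Maps are written on the right; $\mathrm{Inn}(F_2)$ is the group of inner automorphisms of $F_2$. A basis of $F_2$ is a free generating set. For a basis $A'$ of $G=F_2$, $d_{A'}$ denotes the word metric on $G$ with respect to $A'\cup A'^{-1}$. Gromov product: $(g|h)_p^{A'} = \frac12(d_{A'}(p,g)+d_{A'}(p,h)-d_{A'}(g,h))$. Let $\rho^{A'}_{p,\gamma}(g,h) = e^{-\gamma (g|h)_p^{A'}}$ if $g \ne h$ and $0$ otherwise. For $p \in G$, $\gamma>0$, $T\ge 1$, $V^{A'}(p,\gamma,T)$ is the set of all metrics $d$ on $G$ with $\frac1T\rho^{A'}_{p,\gamma}(g,h) \le d(g,h) \le T\rho^{A'}_{p,\gamma}(g,h)$ for all distinct $g,h\in G$; its elements are visual metrics. $\varphi$ satisfies a Lipschitz condition for $d$ if there is $K>0$ with $d(g\varphi,h\varphi)\le K\,d(g,h)$ for all $g,h\in G$.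 *)

theory Defs
  imports "HOL-Algebra.Algebra" "HOL-Analysis.Abstract_Metric_Spaces"
begin

section \<open>Words and bases\<close>

text \<open>
  A word over \<open>A \<union> A\<inverse>\<close> is a list of signed letters: \<open>(x, True)\<close> stands for \<open>x\<close> and
  \<open>(x, False)\<close> for the inverse of \<open>x\<close>.
\<close>

definition words :: "'a set \<Rightarrow> ('a \<times> bool) list set"
  where "words A = lists (A \<times> UNIV)"

definition letter_val :: "('a, 'm) monoid_scheme \<Rightarrow> 'a \<times> bool \<Rightarrow> 'a"
  where "letter_val G l = (if snd l then fst l else inv\<^bsub>G\<^esub> (fst l))"

definition word_val :: "('a, 'm) monoid_scheme \<Rightarrow> ('a \<times> bool) list \<Rightarrow> 'a"
  where "word_val G w = foldr (\<lambda>l g. letter_val G l \<otimes>\<^bsub>G\<^esub> g) w \<one>\<^bsub>G\<^esub>"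

definition reduced :: "('a \<times> bool) list \<Rightarrow> bool"
  where "reduced = successively (\<lambda>k l. \<not> (fst k = fst l \<and> snd k \<noteq> snd l))"

text \<open>
  \<open>A\<close> is a free generating set of \<open>G\<close>: the canonical map from the free group on \<open>A\<close>, realised as
  the set of reduced words, to \<open>G\<close> is bijective.
\<close>

definition free_basis :: "('a, 'm) monoid_scheme \<Rightarrow> 'a set \<Rightarrow> bool"
  where "free_basis G A \<longleftrightarrow>
    A \<subseteq> carrier G \<and> bij_betw (word_val G) {w \<in> words A. reduced w} (carrier G)"

section \<open>Word metrics and visual metrics\<close>

text \<open>
  The distance from \<open>g\<close> to \<open>h\<close> is that in the Cayley graph with edges from \<open>g\<close> to \<open>g \<otimes> x\<close>, for
  \<open>x\<close> in \<open>A \<union> A\<inverse>\<close>. It is the expected number when \<open>A\<close> generates \<open>G\<close> and \<open>g\<close>, \<open>h\<close> lie in \<open>G\<close>.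
\<close>

definition word_dist :: "('a, 'm) monoid_scheme \<Rightarrow> 'a set \<Rightarrow> 'a \<Rightarrow> 'a \<Rightarrow> nat"
  where "word_dist G A g h = (LEAST n. \<exists>w \<in> words A. length w = n \<and> g \<otimes>\<^bsub>G\<^esub> word_val G w = h)"

definition gromov_prod :: "('a, 'm) monoid_scheme \<Rightarrow> 'a set \<Rightarrow> 'a \<Rightarrow> 'a \<Rightarrow> 'a \<Rightarrow> real"
  where "gromov_prod G A p g h =
    (real (word_dist G A p g) + real (word_dist G A p h) - real (word_dist G A g h)) / 2"

definition visual_rho :: "('a, 'm) monoid_scheme \<Rightarrow> 'a set \<Rightarrow> 'a \<Rightarrow> real \<Rightarrow> 'a \<Rightarrow> 'a \<Rightarrow> real"
  where "visual_rho G A p \<gamma> g h = (if g \<noteq> h then exp (- \<gamma> * gromov_prod G A p g h) else 0)"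

text \<open>
  \<^locale>\<open>Metric_space\<close> also asks for non-negativity and symmetry outside the carrier. Every metric on
  the carrier extends by \<open>0\<close> to such a function, so no metric is excluded.
\<close>

definition visual_metrics ::
    "('a, 'm) monoid_scheme \<Rightarrow> 'a set \<Rightarrow> 'a \<Rightarrow> real \<Rightarrow> real \<Rightarrow> ('a \<Rightarrow> 'a \<Rightarrow> real) set"
  where "visual_metrics G A p \<gamma> T =
    {d. Metric_space (carrier G) d \<and>
        (\<forall>g \<in> carrier G. \<forall>h \<in> carrier G. g \<noteq> h \<longrightarrow>
           1 / T * visual_rho G A p \<gamma> g h \<le> d g h \<and> d g h \<le> T * visual_rho G A p \<gamma> g h)}"

definition lipschitz_condition :: "'a set \<Rightarrow> ('a \<Rightarrow> 'a \<Rightarrow> real) \<Rightarrow> ('a \<Rightarrow> 'a) \<Rightarrow> bool"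
  where "lipschitz_condition S d f \<longleftrightarrow>
    (\<exists>K>0. \<forall>g \<in> S. \<forall>h \<in> S. d (f g) (f h) \<le> K * d g h)"

section \<open>Inner automorphisms\<close>

text \<open>
  Automorphisms are the elements of \<^const>\<open>auto\<close>, that is, functions that are \<^const>\<open>undefined\<close>
  outside the carrier. The multiplication of \<^const>\<open>AutoGroup\<close> applies its right factor first. For
  maps written on the right the left factor acts first, so a product of subsets \<open>X Y\<close> in that
  convention is \<open>Y <#> X\<close> in \<^const>\<open>AutoGroup\<close>.
\<close>

definition Inn :: "('a, 'm) monoid_scheme \<Rightarrow> ('a \<Rightarrow> 'a) set"
  where "Inn G = {\<lambda>x \<in> carrier G. inv\<^bsub>G\<^esub> g \<otimes>\<^bsub>G\<^esub> x \<otimes>\<^bsub>G\<^esub> g | g. g \<in> carrier G}"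

end

theory Submission
  imports Defs "HOL-Analysis.Determinants" "HOL-Real_Asymp.Real_Asymp" "HOL-Library.Sublist"
begin

text \<open>
  Up to an additive constant the Gromov product depends only on word lengths, so automorphisms that
  distort the length of every basis by a bounded amount satisfy all the Lipschitz conditions.
  Conversely, a Lipschitz condition for the ultrametric \<open>exp (- (g|h))\<close> of a basis \<open>B\<close> gives
  \<open>|g| \<le> |g\<phi>| + C\<close>; hence \<open>\<psi> = \<phi>\<inverse>\<close> does not increase the cyclic length of any
  element. For \<open>B = {a, b}\<close> and \<open>B = {a, ab}\<close> together with exponent sums this makes
  \<open>a\<psi>\<close>, \<open>b\<psi>\<close> conjugate to \<open>a\<^sup>s\<close>, \<open>b\<^sup>s\<close> with a common sign \<open>s\<close>, and the cyclic
  length of \<open>(ab)\<psi>\<close> being at most \<open>2\<close> forces a common conjugating element.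

  That \<open>\<epsilon>\<close> is harmless for an arbitrary basis \<open>{x, y}\<close> amounts to: the automorphism
  \<open>\<epsilon>'\<close> inverting \<open>x\<close> and \<open>y\<close> agrees with \<open>\<epsilon>\<close> up to an inner automorphism. Instead of
  Nielsen's theorem we use representations \<open>\<rho>\<^sub>t\<close> in \<open>SL\<^sub>2(\<real>)\<close> for which the trace of \<open>\<rho>\<^sub>t(g)\<close>
  grows like \<open>t\<close> to the power of the cyclic length of \<open>g\<close>. Conjugation by
  \<open>J = XY - YX\<close> inverts both \<open>X\<close> and \<open>Y\<close> in \<open>SL\<^sub>2\<close>, so \<open>\<rho>\<^sub>t(g)\<close> and
  \<open>\<rho>\<^sub>t(g\<epsilon>')\<close> have the same trace and \<open>\<epsilon>'\<close> preserves cyclic lengths with respect to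
  \<open>{a, b}\<close>.
\<close>

section \<open>Reduced words\<close>

definition letter_inv :: "'a \<times> bool \<Rightarrow> 'a \<times> bool"
  where "letter_inv l = (fst l, \<not> snd l)"

lemma fst_letter_inv [simp]: "fst (letter_inv l) = fst l"
  and snd_letter_inv [simp]: "snd (letter_inv l) = (\<not> snd l)"
  and letter_inv_inv [simp]: "letter_inv (letter_inv l) = l"
  by (auto simp: letter_inv_def prod_eq_iff)

lemma reduced_altdef: "reduced = successively (\<lambda>k l. l \<noteq> letter_inv k)"
  unfolding reduced_def by (intro ext successively_cong) (auto simp: letter_inv_def prod_eq_iff)

lemma reduced_Nil [simp]: "reduced []"
  and reduced_Cons: "reduced (l # w) \<longleftrightarrow> w = [] \<or> hd w \<noteq> letter_inv l \<and> reduced w"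
  and reduced_append: "reduced (v @ w) \<longleftrightarrow>
    reduced v \<and> reduced w \<and> (v = [] \<or> w = [] \<or> hd w \<noteq> letter_inv (last v))"
  by (auto simp: reduced_altdef successively_Cons successively_append_iff)

definition word_inv :: "('a \<times> bool) list \<Rightarrow> ('a \<times> bool) list"
  where "word_inv w = rev (map letter_inv w)"

lemma length_word_inv [simp]: "length (word_inv w) = length w"
  and word_inv_Nil_iff [simp]: "word_inv w = [] \<longleftrightarrow> w = []"
  by (simp_all add: word_inv_def)

lemma hd_word_inv: "w \<noteq> [] \<Longrightarrow> hd (word_inv w) = letter_inv (last w)"
  and last_word_inv: "w \<noteq> [] \<Longrightarrow> last (word_inv w) = letter_inv (hd w)"
  by (simp_all add: word_inv_def hd_rev last_rev last_map hd_map)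

lemma reduced_word_inv [simp]: "reduced (word_inv w) \<longleftrightarrow> reduced w"
proof -
  have "reduced (word_inv w) \<longleftrightarrow>
    successively (\<lambda>x y. letter_inv x \<noteq> letter_inv (letter_inv y)) w"
    by (simp add: reduced_altdef word_inv_def successively_map)
  also have "\<dots> \<longleftrightarrow> reduced w"
    unfolding reduced_altdef
    by (rule successively_cong) (auto simp: letter_inv_def prod_eq_iff)
  finally show ?thesis .
qed

text \<open>Left multiplication by one letter with at most one cancellation. A reduced word stays
  reduced, so folding over a word from the right computes its free reduction.\<close>

fun lcons :: "'a \<times> bool \<Rightarrow> ('a \<times> bool) list \<Rightarrow> ('a \<times> bool) list" where
  "lcons l [] = [l]"
| "lcons l (k # w) = (if k = letter_inv l then w else l # k # w)"

definition normalise :: "('a \<times> bool) list \<Rightarrow> ('a \<times> bool) list"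
  where "normalise w = foldr lcons w []"

lemma reduced_lcons: "reduced w \<Longrightarrow> reduced (lcons l w)"
  by (cases w) (auto simp: reduced_Cons)

lemma reduced_normalise: "reduced (normalise w)"
  by (induction w) (auto simp: normalise_def reduced_lcons)

lemma length_lcons: "length (lcons l w) \<le> Suc (length w)"
  by (cases w) auto

lemma length_normalise: "length (normalise w) \<le> length w"
proof (induction w)
  case (Cons l w)
  then show ?case using length_lcons[of l "normalise w"] by (simp add: normalise_def)
qed (simp add: normalise_def)

lemma words_Nil [simp]: "[] \<in> words A"
  and words_Cons [simp]: "l # w \<in> words A \<longleftrightarrow> fst l \<in> A \<and> w \<in> words A"
  and words_append [simp]: "v @ w \<in> words A \<longleftrightarrow> v \<in> words A \<and> w \<in> words A"
  by (auto simp: words_def mem_Times_iff)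

lemma words_iff: "w \<in> words A \<longleftrightarrow> fst ` set w \<subseteq> A"
  by (auto simp: words_def lists_eq_set)

lemma words_hd: "w \<in> words A \<Longrightarrow> w \<noteq> [] \<Longrightarrow> fst (hd w) \<in> A"
  and words_last: "w \<in> words A \<Longrightarrow> w \<noteq> [] \<Longrightarrow> fst (last w) \<in> A"
  by (auto simp: words_iff)

lemma words_word_inv [simp]: "word_inv w \<in> words A \<longleftrightarrow> w \<in> words A"
  by (simp add: words_iff word_inv_def image_image)

lemma words_lcons: "fst l \<in> A \<Longrightarrow> w \<in> words A \<Longrightarrow> lcons l w \<in> words A"
  by (cases w) auto

lemma words_normalise: "w \<in> words A \<Longrightarrow> normalise w \<in> words A"
  by (induction w) (auto simp: normalise_def words_lcons)

section \<open>Substitution of letters and values of words\<close>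

definition map_word :: "('a \<Rightarrow> 'b) \<Rightarrow> ('a \<times> bool) list \<Rightarrow> ('b \<times> bool) list"
  where "map_word f = map (map_prod f id)"

lemma map_word_simps [simp]:
  "map_word f [] = []"
  "map_word f (l # w) = (f (fst l), snd l) # map_word f w"
  "map_word f (v @ w) = map_word f v @ map_word f w"
  "length (map_word f w) = length w"
  by (simp_all add: map_word_def map_prod_def case_prod_beta)

lemma map_word_words: "w \<in> words A \<Longrightarrow> f ` A \<subseteq> B \<Longrightarrow> map_word f w \<in> words B"
  by (induction w) auto

lemma map_word_id [simp]: "map_word (\<lambda>x. x) w = w"
  by (induction w) auto

lemma letter_val_simps [simp]:
  "letter_val G (x, True) = x" "letter_val G (x, False) = inv\<^bsub>G\<^esub> x"
  by (simp_all add: letter_val_def)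

lemma word_val_Nil [simp]: "word_val G [] = \<one>\<^bsub>G\<^esub>"
  and word_val_Cons: "word_val G (l # w) = letter_val G l \<otimes>\<^bsub>G\<^esub> word_val G w"
  by (simp_all add: word_val_def)

context group begin

lemma letter_val_closed: "fst l \<in> carrier G \<Longrightarrow> letter_val G l \<in> carrier G"
  by (simp add: letter_val_def)

lemma word_val_closed: "w \<in> words (carrier G) \<Longrightarrow> word_val G w \<in> carrier G"
  by (induction w) (auto simp: word_val_Cons letter_val_closed)

lemma letter_val_inv: "fst l \<in> carrier G \<Longrightarrow> letter_val G (letter_inv l) = inv (letter_val G l)"
  by (simp add: letter_val_def letter_inv_def)

lemma word_val_append:
  "v \<in> words (carrier G) \<Longrightarrow> w \<in> words (carrier G) \<Longrightarrow>
    word_val G (v @ w) = word_val G v \<otimes> word_val G w"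
  by (induction v) (auto simp: word_val_Cons letter_val_closed word_val_closed m_assoc)

lemma word_val_inv:
  "w \<in> words (carrier G) \<Longrightarrow> word_val G (word_inv w) = inv (word_val G w)"
proof (induction w)
  case (Cons l w)
  have "word_val G (word_inv (l # w)) = word_val G (word_inv w @ [letter_inv l])"
    by (simp add: word_inv_def)
  also have "\<dots> = inv (word_val G w) \<otimes> inv (letter_val G l)"
    using Cons by (subst word_val_append) (auto simp: word_val_Cons letter_val_inv letter_val_closed)
  finally show ?case
    using Cons by (simp add: word_val_Cons inv_mult_group letter_val_closed word_val_closed)
qed (simp add: word_inv_def)

lemma word_val_lcons:
  assumes "f (fst l) \<in> carrier G" "map_word f w \<in> words (carrier G)"
  shows "word_val G (map_word f (lcons l w)) =
    letter_val G (f (fst l), snd l) \<otimes> word_val G (map_word f w)"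
proof (cases w)
  case (Cons k u)
  let ?x = "letter_val G (f (fst l), snd l)"
  have "?x \<otimes> (letter_val G (f (fst l), \<not> snd l) \<otimes> word_val G (map_word f u)) =
      word_val G (map_word f u)"
    using assms Cons by (simp add: m_assoc[symmetric] letter_val_def word_val_closed)
  then show ?thesis using Cons by (auto simp: word_val_Cons letter_inv_def)
qed (simp add: word_val_Cons)

text \<open>Any substitution \<open>f\<close> sends a cancelling pair of letters to mutually inverse
  elements. The identity as \<open>f\<close> yields normal forms, other maps into a group yield the
  universal property.\<close>

lemma word_val_normalise:
  assumes "map_word f w \<in> words (carrier G)"
  shows "word_val G (map_word f (normalise w)) = word_val G (map_word f w)"
  using assms
proof (induction w)
  case (Cons l w)
  have *: "f ` fst ` set (l # w) \<subseteq> carrier G"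
    using Cons.prems by (simp add: words_iff map_word_def image_image)
  have "map_word f (normalise w) \<in> words (carrier G)"
    by (rule map_word_words[of _ "fst ` set w", OF words_normalise]) (use * in \<open>auto simp: words_iff\<close>)
  then show ?case
    using Cons by (simp add: normalise_def word_val_lcons word_val_Cons)
qed (simp add: normalise_def)

lemma hom_word_val:
  assumes "group H" "h \<in> hom G H" "w \<in> words (carrier G)"
  shows "h (word_val G w) = word_val H (map_word h w)"
proof -
  note closed = word_val_closed
  interpret group_hom G H h using assms by (simp add: group_hom_def group_hom_axioms_def)
  show ?thesis using assms(3)
  proof (induction w)
    case (Cons l w)
    moreover have "word_val G w \<in> carrier G" using Cons by (simp add: closed)
    ultimately show ?case by (simp add: word_val_Cons letter_val_def)
  qed simp
qed

end

section \<open>Normal forms in free groups\<close>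

locale free_group = group G for G (structure) +
  fixes A :: "'a set"
  assumes basis: "free_basis G A"
begin

lemma basis_subset: "A \<subseteq> carrier G"
  using basis by (simp add: free_basis_def)

lemma basis_closed [simp]: "x \<in> A \<Longrightarrow> x \<in> carrier G"
  using basis_subset by blast

lemma words_carrier: "w \<in> words A \<Longrightarrow> w \<in> words (carrier G)"
  using basis_subset by (auto simp: words_iff)

definition nf :: "'a \<Rightarrow> ('a \<times> bool) list"
  where "nf = the_inv_into {w \<in> words A. reduced w} (word_val G)"

definition len :: "'a \<Rightarrow> nat"
  where "len g = length (nf g)"

lemma inj_word_val: "inj_on (word_val G) {w \<in> words A. reduced w}"
  and image_word_val: "word_val G ` {w \<in> words A. reduced w} = carrier G"
  using basis by (auto simp: free_basis_def bij_betw_def)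

lemma nf_word_val: "w \<in> words A \<Longrightarrow> reduced w \<Longrightarrow> nf (word_val G w) = w"
  unfolding nf_def by (rule the_inv_into_f_f[OF inj_word_val]) auto

lemma
  assumes "g \<in> carrier G"
  shows nf_words: "nf g \<in> words A" and reduced_nf: "reduced (nf g)"
    and word_val_nf: "word_val G (nf g) = g"
proof -
  obtain w where "w \<in> words A" "reduced w" "g = word_val G w"
    using assms image_word_val by blast
  then show "nf g \<in> words A" "reduced (nf g)" "word_val G (nf g) = g"
    by (simp_all add: nf_word_val)
qed

lemma nf_word_val_normalise: "w \<in> words A \<Longrightarrow> nf (word_val G w) = normalise w"
  using nf_word_val[of "normalise w"] word_val_normalise[of "\<lambda>x. x" w]
  by (simp add: words_normalise reduced_normalise words_carrier)

lemma nf_mult: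
  assumes "g \<in> carrier G" "h \<in> carrier G"
  shows "nf (g \<otimes> h) = normalise (nf g @ nf h)"
  using assms nf_word_val_normalise[of "nf g @ nf h"]
  by (simp add: word_val_append words_carrier nf_words word_val_nf)

lemma nf_inv: "g \<in> carrier G \<Longrightarrow> nf (inv g) = word_inv (nf g)"
  using nf_word_val[of "word_inv (nf g)"]
  by (simp add: word_val_inv words_carrier nf_words word_val_nf reduced_nf)

lemma nf_one [simp]: "nf \<one> = []"
  using nf_word_val[of "[]"] by simp

lemma nf_basis: "x \<in> A \<Longrightarrow> nf x = [(x, True)]"
  using nf_word_val[of "[(x, True)]"] by (simp add: word_val_Cons reduced_Cons)

lemma nf_Nil_iff: "g \<in> carrier G \<Longrightarrow> nf g = [] \<longleftrightarrow> g = \<one>"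
  using word_val_nf by fastforce

lemma len_word_val: "w \<in> words A \<Longrightarrow> len (word_val G w) \<le> length w"
  by (simp add: len_def nf_word_val_normalise length_normalise)

lemma len_one [simp]: "len \<one> = 0"
  by (simp add: len_def)

lemma len_eq_0_iff: "g \<in> carrier G \<Longrightarrow> len g = 0 \<longleftrightarrow> g = \<one>"
  by (simp add: len_def nf_Nil_iff)

lemma len_inv: "g \<in> carrier G \<Longrightarrow> len (inv g) = len g"
  by (simp add: len_def nf_inv)

lemma len_mult: "g \<in> carrier G \<Longrightarrow> h \<in> carrier G \<Longrightarrow> len (g \<otimes> h) \<le> len g + len h"
  using length_normalise[of "nf g @ nf h"] by (simp add: len_def nf_mult)

lemma len_conj:
  assumes "g \<in> carrier G" "h \<in> carrier G"
  shows "len (h \<otimes> g \<otimes> inv h) \<le> len g + 2 * len h"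
  using assms len_mult[of "h \<otimes> g" "inv h"] len_mult[of h g] by (simp add: len_inv)

lemma len_basis: "x \<in> A \<Longrightarrow> len x = 1"
  by (simp add: len_def nf_basis)

text \<open>Word distance is invariant under left translation, and a normal form is a shortest word
  for its value because free reduction never lengthens a word.\<close>

lemma word_dist_eq_len:
  assumes "g \<in> carrier G" "h \<in> carrier G"
  shows "word_dist G A g h = len (inv g \<otimes> h)"
  unfolding word_dist_def
proof (rule Least_equality)
  have "g \<otimes> word_val G (nf (inv g \<otimes> h)) = h"
    using assms by (simp add: word_val_nf m_assoc[symmetric])
  then show "\<exists>w\<in>words A. length w = len (inv g \<otimes> h) \<and> g \<otimes> word_val G w = h"
    using assms by (intro bexI[of _ "nf (inv g \<otimes> h)"]) (auto simp: len_def nf_words)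
next
  fix n assume "\<exists>w\<in>words A. length w = n \<and> g \<otimes> word_val G w = h"
  then obtain w where w: "w \<in> words A" "length w = n" "g \<otimes> word_val G w = h" by blast
  have "inv g \<otimes> h = word_val G w"
    using w assms word_val_closed[OF words_carrier] by (auto simp: m_assoc[symmetric])
  then show "len (inv g \<otimes> h) \<le> n" using len_word_val w by auto
qed

section \<open>Universal property of the free group\<close>

definition extend :: "('c, 'n) monoid_scheme \<Rightarrow> ('a \<Rightarrow> 'c) \<Rightarrow> 'a \<Rightarrow> 'c"
  where "extend H f g = word_val H (map_word f (nf g))"

text \<open>The normal form of a product is the free reduction of the concatenated normal forms, and
  free reduction does not affect the value after substitution.\<close>

lemma extend_hom:
  assumes "group H" "f ` A \<subseteq> carrier H"
  shows "extend H f \<in> hom G H"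
proof (rule homI)
  fix g assume "g \<in> carrier G"
  then show "extend H f g \<in> carrier H"
    unfolding extend_def
    by (intro group.word_val_closed[OF assms(1)] map_word_words[OF nf_words] assms(2))
next
  fix g h assume gh: "g \<in> carrier G" "h \<in> carrier G"
  have *: "map_word f (nf g) \<in> words (carrier H)" "map_word f (nf h) \<in> words (carrier H)"
    using gh assms(2) by (auto intro!: map_word_words nf_words)
  then show "extend H f (g \<otimes> h) = extend H f g \<otimes>\<^bsub>H\<^esub> extend H f h"
    using gh by (simp add: extend_def nf_mult group.word_val_normalise[OF assms(1)]
        group.word_val_append[OF assms(1)])
qed

lemma extend_basis:
  assumes "group H" "f ` A \<subseteq> carrier H" "x \<in> A"
  shows "extend H f x = f x"
proof -
  interpret H: group H by fact
  show ?thesis using assms(2,3) by (auto simp: extend_def nf_basis word_val_Cons)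
qed

lemma hom_eqI:
  assumes "group H" "h \<in> hom G H" "k \<in> hom G H" "\<And>x. x \<in> A \<Longrightarrow> h x = k x"
    and "g \<in> carrier G"
  shows "h g = k g"
proof -
  have "map_word h w = map_word k w" if "w \<in> words A" for w
    using that assms(4) by (induction w) auto
  then show ?thesis
    using assms(5) hom_word_val[OF assms(1,2), of "nf g"] hom_word_val[OF assms(1,3), of "nf g"]
    by (simp add: nf_words words_carrier word_val_nf)
qed

section \<open>Exponent sums\<close>

definition expo :: "'a \<Rightarrow> 'a \<Rightarrow> int"
  where "expo x = extend integer_group (\<lambda>y. if y = x then 1 else 0)"

lemma expo_hom: "expo x \<in> hom G integer_group"
  unfolding expo_def by (rule extend_hom) auto

lemma expo_basis: "y \<in> A \<Longrightarrow> expo x y = (if y = x then 1 else 0)"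
  unfolding expo_def by (subst extend_basis) auto

lemma expo_mult: "g \<in> carrier G \<Longrightarrow> h \<in> carrier G \<Longrightarrow> expo x (g \<otimes> h) = expo x g + expo x h"
  using hom_mult[OF expo_hom] by simp

lemma expo_inv: "g \<in> carrier G \<Longrightarrow> expo x (inv g) = - expo x g"
  using group_hom.hom_inv[of G integer_group "expo x" g] expo_hom
  by (simp add: group_hom_def group_hom_axioms_def)

lemma expo_conj: "g \<in> carrier G \<Longrightarrow> h \<in> carrier G \<Longrightarrow> expo x (h \<otimes> g \<otimes> inv h) = expo x g"
  by (simp add: expo_mult expo_inv)

text \<open>Such a combination is itself a homomorphism to the integers, hence determined by its
  values on the basis. Three terms are allowed because the rank is found from the dependence of
  three vectors in the plane.\<close>

lemma hom_combination_eq_0: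
  assumes homs: "f\<^sub>1 \<in> hom G integer_group" "f\<^sub>2 \<in> hom G integer_group" "f\<^sub>3 \<in> hom G integer_group"
    and zero: "\<And>x. x \<in> A \<Longrightarrow> c\<^sub>1 * f\<^sub>1 x + c\<^sub>2 * f\<^sub>2 x + c\<^sub>3 * f\<^sub>3 x = 0"
    and "g \<in> carrier G"
  shows "c\<^sub>1 * f\<^sub>1 g + c\<^sub>2 * f\<^sub>2 g + c\<^sub>3 * f\<^sub>3 g = 0"
proof -
  have "(\<lambda>g. c\<^sub>1 * f\<^sub>1 g + c\<^sub>2 * f\<^sub>2 g + c\<^sub>3 * f\<^sub>3 g) \<in> hom G integer_group"
    using homs by (auto simp: hom_def distrib_left)
  moreover have "(\<lambda>g. 0) \<in> hom G integer_group"
    by (auto simp: hom_def)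
  ultimately show ?thesis
    using hom_eqI[of integer_group "\<lambda>g. c\<^sub>1 * f\<^sub>1 g + c\<^sub>2 * f\<^sub>2 g + c\<^sub>3 * f\<^sub>3 g" "\<lambda>g. 0" g] zero assms(5)
    by simp
qed

section \<open>The automorphism inverting a basis\<close>

definition flip :: "'a \<Rightarrow> 'a"
  where "flip = extend G (\<lambda>x. inv x)"

lemma flip_hom: "flip \<in> hom G G"
  unfolding flip_def by (rule extend_hom) (use basis_subset in auto)

lemma flip_basis: "x \<in> A \<Longrightarrow> flip x = inv x"
  unfolding flip_def by (rule extend_basis) (use basis_subset in auto)

lemma flip_closed: "g \<in> carrier G \<Longrightarrow> flip g \<in> carrier G"
  by (rule hom_in_carrier[OF flip_hom])

text \<open>Only the signs of the letters in the normal form change, and this creates no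
  cancellation.\<close>

lemma len_flip: assumes "g \<in> carrier G" shows "len (flip g) = len g"
proof -
  have "flip g = word_val G (map letter_inv (nf g))"
  proof -
    have "word_val G (map_word (\<lambda>x. inv x) w) = word_val G (map letter_inv w)" if "w \<in> words A" for w
      using that by (induction w) (auto simp: word_val_Cons letter_val_def)
    then show ?thesis using assms by (simp add: flip_def extend_def nf_words)
  qed
  moreover have "map letter_inv (nf g) \<in> words A"
    using nf_words[OF assms] by (simp add: words_iff image_image)
  moreover have "reduced (map letter_inv w)" if "reduced w" for w :: "('a \<times> bool) list"
    using that unfolding reduced_altdef successively_map by (rule successively_mono) (metis letter_inv_inv)
  ultimately show ?thesis
    using reduced_nf[OF assms] by (simp add: len_def nf_word_val)
qed

lemma flip_flip: assumes "g \<in> carrier G" shows "flip (flip g) = g"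
proof (rule hom_eqI[of G "flip \<circ> flip" "\<lambda>x. x", simplified])
  show "flip \<circ> flip \<in> hom G G" using flip_hom by (auto simp: hom_def Pi_iff)
  show "(\<lambda>x. x) \<in> hom G G" by (simp add: hom_def)
  have "flip (inv x) = inv (flip x)" if "x \<in> A" for x
    using that flip_hom group_hom.hom_inv[of G G flip x] by (simp add: group_hom_def group_hom_axioms_def is_group)
  then show "flip (flip x) = x" if "x \<in> A" for x using that by (simp add: flip_basis)
qed (use assms in auto)

end

text \<open>\<open>map_word \<theta>\<close> matches the reduced words over the two sets, and
  evaluating after it amounts to applying \<open>\<theta>\<close> to the value.\<close>

lemma (in group) free_basis_bij_image:
  assumes "free_basis G A" "\<theta> \<in> hom G G" "bij_betw \<theta> (carrier G) (carrier G)"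
  shows "free_basis G (\<theta> ` A)"
  unfolding free_basis_def
proof
  interpret free_group G A using assms by unfold_locales
  show sub: "\<theta> ` A \<subseteq> carrier G" using hom_in_carrier[OF assms(2)] basis_subset by auto
  have inj: "inj_on \<theta> A" using assms(3) basis_subset by (auto simp: bij_betw_def intro: inj_on_subset)
  let ?R = "\<lambda>A. {w \<in> words A. reduced w}"
  have 1: "bij_betw (map_word \<theta>) (?R A) (?R (\<theta> ` A))"
  proof (rule bij_betw_imageI)
    show "inj_on (map_word \<theta>) (?R A)"
    proof (rule inj_onI)
      fix v w assume "v \<in> ?R A" "w \<in> ?R A" "map_word \<theta> v = map_word \<theta> w"
      then have "v \<in> words A" "w \<in> words A" "map_word \<theta> v = map_word \<theta> w" by auto
      then show "v = w"
      proof (induction v arbitrary: w)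
        case (Cons l v)
        then show ?case by (cases w) (auto simp: prod_eq_iff inj_onD[OF inj])
      qed (metis length_0_conv map_word_simps(4))
    qed
    have red: "reduced (map_word \<theta> w) \<longleftrightarrow> reduced w" if "w \<in> words A" for w
      using that
    proof (induction w)
      case (Cons l w)
      then show ?case
        by (cases w) (auto simp: reduced_Cons letter_inv_def prod_eq_iff inj_on_eq_iff[OF inj])
    qed simp
    have "\<exists>v\<in>words A. w = map_word \<theta> v" if "w \<in> words (\<theta> ` A)" for w
      using that
    proof (induction w)
      case (Cons l w)
      then obtain v x where "v \<in> words A" "w = map_word \<theta> v" "x \<in> A" "fst l = \<theta> x" by auto
      then show ?case by (intro bexI[of _ "(x, snd l) # v"]) (auto simp: prod_eq_iff)
    qed (auto intro: bexI[of _ "[]"])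
    then show "map_word \<theta> ` ?R A = ?R (\<theta> ` A)"
      using red by (auto intro!: map_word_words)
  qed
  have "bij_betw (\<theta> \<circ> word_val G) (?R A) (carrier G)"
    using basis assms(3) by (auto simp: free_basis_def intro: bij_betw_trans)
  then have "bij_betw (word_val G \<circ> map_word \<theta>) (?R A) (carrier G)"
    by (rule bij_betw_cong[THEN iffD1, rotated])
      (auto simp: hom_word_val[OF is_group assms(2)] words_carrier)
  then show "bij_betw (word_val G) (?R (\<theta> ` A)) (carrier G)"
    using bij_betw_comp_iff[OF 1] by blast
qed

section \<open>Cyclic length\<close>

text \<open>The cyclic length of an element is \<open>len c\<close> for a conjugate \<open>c\<close>
  whose normal form is cyclically reduced. It gets no constant of its own; the lemmas speak of such
  a \<open>c\<close> directly.\<close>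

definition cyc_reduced :: "('a \<times> bool) list \<Rightarrow> bool"
  where "cyc_reduced w \<longleftrightarrow> reduced w \<and> (w \<noteq> [] \<longrightarrow> hd w \<noteq> letter_inv (last w))"

lemma reduced_concat_replicate:
  assumes "cyc_reduced w"
  shows "reduced (concat (replicate n w))"
proof (cases "w = []")
  case False
  \<comment> \<open>The first letter is carried along because it decides whether a further copy of
    \<open>w\<close> put in front cancels.\<close>
  have "reduced (concat (replicate n w)) \<and> (n > 0 \<longrightarrow> hd (concat (replicate n w)) = hd w)"
  proof (induction n)
    case (Suc n)
    then show ?case
      using assms False by (cases n) (auto simp: reduced_append cyc_reduced_def)
  qed simp
  then show ?thesis by simp
qed simp

context free_group begin

lemma nf_pow:
  assumes "c \<in> carrier G" "cyc_reduced (nf c)"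
  shows "nf (c [^] n) = concat (replicate n (nf c))"
proof -
  have "concat (replicate n (nf c)) \<in> words A \<and> word_val G (concat (replicate n (nf c))) = c [^] n" for n :: nat
  proof (induction n)
    case (Suc n)
    \<comment> \<open>Powers grow on the right, while \<open>replicate\<close> adds its copies in
      front.\<close>
    have "c \<otimes> c [^] n = c [^] n \<otimes> c"
      using nat_pow_Suc2[OF assms(1)] by simp
    then show ?case
      using Suc assms(1)
      by (simp add: nf_words word_val_append words_carrier word_val_nf)
  qed simp
  then show ?thesis
    using nf_word_val reduced_concat_replicate[OF assms(2)] by metis
qed

lemma len_pow:
  "c \<in> carrier G \<Longrightarrow> cyc_reduced (nf c) \<Longrightarrow> len (c [^] (n :: nat)) = n * len c"
  by (simp add: len_def nf_pow length_concat sum_list_replicate)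

lemma conj_pow:
  assumes "c \<in> carrier G" "h \<in> carrier G"
  shows "(h \<otimes> c \<otimes> inv h) [^] (n :: nat) = h \<otimes> c [^] n \<otimes> inv h"
proof (induction n)
  case (Suc n)
  have "inv h \<otimes> (h \<otimes> x) = x" if "x \<in> carrier G" for x
    using that assms by (simp add: m_assoc[symmetric])
  then show ?case using Suc assms by (simp add: m_assoc)
qed (use assms in simp)

text \<open>Powers of a cyclically reduced element have length exactly \<open>n * len c\<close>, and
  conjugation changes this by at most \<open>2 * len h\<close>. So any linear growth rate of the
  powers bounds the cyclic length.\<close>

lemma len_le_of_pow_bound:
  assumes "c \<in> carrier G" "h \<in> carrier G" "cyc_reduced (nf c)"
    and bound: "\<And>n :: nat. len ((h \<otimes> c \<otimes> inv h) [^] n) \<le> k * n + C"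
  shows "len c \<le> k"
proof (rule ccontr)
  assume "\<not> len c \<le> k"
  \<comment> \<open>Chosen so that \<open>n\<close> exceeds the sum of the additive
    constants.\<close>
  define n where "n = Suc (C + 2 * len h)"
  have "c [^] n = inv h \<otimes> (h \<otimes> c [^] n \<otimes> inv h) \<otimes> inv (inv h)"
    using assms by (simp add: m_assoc[symmetric]) (simp add: m_assoc)
  then have "n * len c \<le> len (h \<otimes> c [^] n \<otimes> inv h) + 2 * len h"
    using assms len_conj[of "h \<otimes> c [^] n \<otimes> inv h" "inv h"] by (simp add: len_pow len_inv)
  also have "\<dots> \<le> k * n + C + 2 * len h"
    using bound[of n] assms by (simp add: conj_pow)
  finally have "n * len c < Suc k * n" by (simp add: n_def)
  moreover have "Suc k * n \<le> n * len c"
    using \<open>\<not> len c \<le> k\<close> mult_le_mono[of n n "Suc k" "len c"] by (simp add: mult.commute)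
  ultimately show False by simp
qed

lemma pow_bound_of_conj:
  assumes "c \<in> carrier G" "h \<in> carrier G"
  shows "len ((h \<otimes> c \<otimes> inv h) [^] (n :: nat)) \<le> len c * n + 2 * len h"
proof -
  have "len (c [^] n) \<le> len c * n"
  proof (induction n)
    case (Suc n)
    then show ?case using len_mult[of "c [^] n" c] assms by simp
  qed simp
  then show ?thesis using len_conj[of "c [^] n" h] assms by (simp add: conj_pow)
qed

text \<open>A first letter that cancels against the last one is moved into the conjugating element,
  which shortens the word; hence the induction on length.\<close>

lemma exists_cyc_reduced_conj:
  assumes "g \<in> carrier G"
  obtains c h where "c \<in> carrier G" "h \<in> carrier G" "g = h \<otimes> c \<otimes> inv h" "cyc_reduced (nf c)"
proof -
  have "\<exists>c h. c \<in> carrier G \<and> h \<in> carrier G \<and> g = h \<otimes> c \<otimes> inv h \<and> cyc_reduced (nf c)"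
    using assms
  proof (induction "len g" arbitrary: g rule: less_induct)
    case less
    show ?case
    proof (cases "cyc_reduced (nf g)")
      case True
      then show ?thesis using less.prems by (intro exI[of _ g] exI[of _ \<one>]) simp
    next
      case False
      then have ne: "nf g \<noteq> []" and hd: "hd (nf g) = letter_inv (last (nf g))"
        using reduced_nf[OF less.prems] by (auto simp: cyc_reduced_def)
      obtain l u where lu: "nf g = l # u" using ne by (cases "nf g") auto
      \<comment> \<open>A letter is not its own inverse, so the first and the last letter sit at
        different positions.\<close>
      have "u \<noteq> []"
        using hd lu by (auto simp: letter_inv_def prod_eq_iff)
      then obtain v k where "u = v @ [k]" by (metis rev_exhaust)
      then have nf: "nf g = l # v @ [letter_inv l]" using lu hd by auto
      let ?c = "word_val G v" and ?x = "letter_val G l"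
      have v: "v \<in> words A" "fst l \<in> A" using nf_words[OF less.prems] nf by auto
      then have closed: "?c \<in> carrier G" "?x \<in> carrier G"
        by (auto simp: word_val_closed words_carrier letter_val_closed)
      have g: "g = ?x \<otimes> ?c \<otimes> inv ?x"
      proof -
        have "g = word_val G (l # v @ [letter_inv l])"
          using word_val_nf[OF less.prems] nf by simp
        then show ?thesis
          using v closed by (simp add: word_val_Cons word_val_append words_carrier letter_val_inv m_assoc)
      qed
      have "len ?c < len g" using len_word_val[OF v(1)] by (simp add: len_def nf)
      from less.hyps[OF this closed(1)] obtain c h where ch:
        "c \<in> carrier G" "h \<in> carrier G" "?c = h \<otimes> c \<otimes> inv h" "cyc_reduced (nf c)" by blast
      have "g = (?x \<otimes> h) \<otimes> c \<otimes> inv (?x \<otimes> h)"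
        unfolding g ch(3) using ch closed by (simp add: m_assoc inv_mult_group)
      then show ?thesis using ch closed by blast
    qed
  qed
  then show ?thesis using that by blast
qed

lemma letter_val_conj_same:
  assumes "fst k = fst l" "fst l \<in> carrier G"
  shows "letter_val G k \<otimes> letter_val G l \<otimes> inv (letter_val G k) = letter_val G l"
  using assms by (cases "snd k"; cases "snd l") (auto simp: letter_val_def m_assoc)

text \<open>If no cancellation between the two conjugating elements is left, the displayed product has
  a cyclically reduced form of length \<open>2\<close> plus twice the length of \<open>inv p \<otimes> q\<close>. Powers of
  the two letters at the ends of \<open>inv p \<otimes> q\<close> can be moved into \<open>p\<close> and \<open>q\<close>.\<close>

lemma common_conjugator:
  assumes ab: "fst k \<in> A" "fst l \<in> A" "fst k \<noteq> fst l"
    and pq: "p \<in> carrier G" "q \<in> carrier G"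
    and bound: "\<And>n :: nat. len (((p \<otimes> letter_val G k \<otimes> inv p) \<otimes>
      (q \<otimes> letter_val G l \<otimes> inv q)) [^] n) \<le> 2 * n + C"
  shows "\<exists>r\<in>carrier G. p \<otimes> letter_val G k \<otimes> inv p = r \<otimes> letter_val G k \<otimes> inv r \<and>
    q \<otimes> letter_val G l \<otimes> inv q = r \<otimes> letter_val G l \<otimes> inv r"
  using pq bound
proof (induction "len (inv p \<otimes> q)" arbitrary: p q rule: less_induct)
  case less
  let ?k = "letter_val G k" and ?l = "letter_val G l"
  have kl: "?k \<in> carrier G" "?l \<in> carrier G" using ab by (simp_all add: letter_val_closed)
  note pq = less.prems(1,2)
  define w where "w = nf (inv p \<otimes> q)"
  have w: "w \<in> words A" "reduced w" "word_val G w = inv p \<otimes> q"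
    using pq by (simp_all add: w_def nf_words reduced_nf word_val_nf)
  have q: "q = p \<otimes> word_val G w" using pq by (simp add: w(3) m_assoc[symmetric])
  have conj_shift: "(r \<otimes> z) \<otimes> x \<otimes> inv (r \<otimes> z) = r \<otimes> (z \<otimes> x \<otimes> inv z) \<otimes> inv r"
    if "r \<in> carrier G" "z \<in> carrier G" "x \<in> carrier G" for r z x
    using that by (simp add: inv_mult_group m_assoc)
  \<comment> \<open>Either the conjugators agree, or a letter at one end of \<open>w\<close> can be
    absorbed, or both ends of \<open>w\<close> are blocked.\<close>
  consider "w = []" | m v where "w = m # v" "fst m = fst k" | m v where "w = v @ [m]" "fst m = fst l"
    | "w \<noteq> []" "fst (hd w) \<noteq> fst k" "fst (last w) \<noteq> fst l"
    by (metis append_butlast_last_id list.collapse)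
  then show ?case
  proof cases
    case 1
    then show ?thesis using q pq by auto
  next
    case 2
    let ?m = "letter_val G m"
    have v: "v \<in> words A" "fst m \<in> A" using w 2 by auto
    have closed: "?m \<in> carrier G" "word_val G v \<in> carrier G"
      using v by (simp_all add: letter_val_closed word_val_closed words_carrier)
    have "inv (p \<otimes> ?m) \<otimes> q = word_val G v"
      unfolding q 2(1) word_val_Cons using closed pq
      by (simp add: inv_mult_group m_assoc) (simp add: m_assoc[symmetric])
    then have "len (inv (p \<otimes> ?m) \<otimes> q) < len (inv p \<otimes> q)"
      using len_word_val[OF v(1)] 2(1) by (simp add: len_def w_def)
    \<comment> \<open>\<open>m\<close> and \<open>k\<close> have the same generator and commute, so
      moving \<open>m\<close> into \<open>p\<close> leaves the conjugate unchanged.\<close>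
    moreover have eq: "(p \<otimes> ?m) \<otimes> ?k \<otimes> inv (p \<otimes> ?m) = p \<otimes> ?k \<otimes> inv p"
      using pq closed kl 2(2) ab by (simp add: conj_shift letter_val_conj_same)
    ultimately show ?thesis
      using less.hyps[of "p \<otimes> ?m" q] pq closed less.prems(3) by (simp only: eq m_closed)
  next
    case 3
    let ?m = "inv (letter_val G m)"
    have v: "v \<in> words A" "fst m \<in> A" using w 3 by auto
    have closed: "?m \<in> carrier G" "letter_val G m \<in> carrier G" "word_val G v \<in> carrier G"
      using v by (simp_all add: letter_val_closed word_val_closed words_carrier)
    have "inv p \<otimes> (q \<otimes> ?m) = word_val G v"
      using pq closed v by (simp add: q 3(1) word_val_append word_val_Cons words_carrier m_assoc)
        (simp add: m_assoc[symmetric])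
    then have "len (inv p \<otimes> (q \<otimes> ?m)) < len (inv p \<otimes> q)"
      using len_word_val[OF v(1)] 3(1) by (simp add: len_def w_def)
    \<comment> \<open>In the same way the last letter of \<open>w\<close> commutes with
      \<open>l\<close>; it is removed from \<open>w\<close> by multiplying \<open>q\<close> with its
      inverse.\<close>
    moreover have eq: "(q \<otimes> ?m) \<otimes> ?l \<otimes> inv (q \<otimes> ?m) = q \<otimes> ?l \<otimes> inv q"
      using pq closed kl 3(2) ab letter_val_conj_same[of "letter_inv m" l]
      by (simp add: conj_shift letter_val_inv)
    ultimately show ?thesis
      using less.hyps[of p "q \<otimes> ?m"] pq closed less.prems(3) by (simp only: eq m_closed)
  next
    case 4
    \<comment> \<open>Up to conjugation by \<open>p\<close> the product is the value of this word.
      The end letters of \<open>w\<close> are not over the generators of \<open>k\<close> and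
      \<open>l\<close>, so nothing cancels even cyclically, and the growth bound \<open>2\<close>
      contradicts \<open>w\<close> being nonempty.\<close>
    let ?W = "k # w @ l # word_inv w"
    have "hd (word_inv w) \<noteq> letter_inv l" "hd w \<noteq> letter_inv k" "l \<noteq> letter_inv (last w)"
      "letter_inv (hd w) \<noteq> letter_inv k" "last (word_inv w) \<noteq> letter_inv k"
      "k \<noteq> letter_inv (last (word_inv w))"
      using 4 by (auto simp: hd_word_inv last_word_inv letter_inv_def prod_eq_iff)
    then have W: "cyc_reduced ?W" "?W \<in> words A"
      using 4(1) w ab by (auto simp: cyc_reduced_def reduced_Cons reduced_append)
    have nfW: "nf (word_val G ?W) = ?W"
      using W by (intro nf_word_val) (auto simp: cyc_reduced_def)
    have closed: "word_val G w \<in> carrier G" using w pq by simp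
    have "(p \<otimes> ?k \<otimes> inv p) \<otimes> (q \<otimes> ?l \<otimes> inv q) = p \<otimes> word_val G ?W \<otimes> inv p"
    proof -
      have "word_val G ?W = ?k \<otimes> (word_val G w \<otimes> ?l \<otimes> inv (word_val G w))"
        using w ab closed kl
        by (simp add: word_val_Cons word_val_append word_val_inv words_carrier m_assoc)
      moreover have "inv p \<otimes> (p \<otimes> x) = x" if "x \<in> carrier G" for x
        using that pq by (simp add: m_assoc[symmetric])
      ultimately show ?thesis
        unfolding q using pq kl closed by (simp add: inv_mult_group m_assoc)
    qed
    then have "len (word_val G ?W) \<le> 2"
      using len_le_of_pow_bound[of "word_val G ?W" p 2 C] less.prems(3) pq W nfW
      by (simp add: word_val_closed[OF words_carrier])
    then show ?thesis using 4(1) nfW by (simp add: len_def)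
  qed
qed

end

section \<open>Traces in SL2\<close>

definition SL2 :: "(real^2^2) monoid"
  where "SL2 = \<lparr>carrier = {M. det M = 1}, monoid.mult = (**), one = mat 1\<rparr>"

text \<open>The adjugate. It is the inverse at determinant \<open>1\<close> and polynomial in the
  entries, so that identities reduce to ring arithmetic.\<close>

definition adj2 :: "real^2^2 \<Rightarrow> real^2^2"
  where "adj2 M = vector [vector [M$2$2, - M$1$2], vector [- M$2$1, M$1$1]]"

lemma carrier_SL2: "M \<in> carrier SL2 \<longleftrightarrow> det M = 1"
  and mult_SL2 [simp]: "M \<otimes>\<^bsub>SL2\<^esub> N = M ** N"
  and one_SL2 [simp]: "\<one>\<^bsub>SL2\<^esub> = mat 1"
  by (simp_all add: SL2_def)

lemma mat2_eq_iff:
  "(M :: real^2^2) = N \<longleftrightarrow> M$1$1 = N$1$1 \<and> M$1$2 = N$1$2 \<and> M$2$1 = N$2$1 \<and> M$2$2 = N$2$2"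
  by (auto simp: vec_eq_iff forall_2)

lemma mat2_simps:
  "((M :: real^2^2) ** N) $ i $ j = M$i$1 * N$1$j + M$i$2 * N$2$j"
  "trace M = M$1$1 + M$2$2"
  "(mat 1 :: real^2^2)$1$1 = 1" "(mat 1 :: real^2^2)$1$2 = 0"
  "(mat 1 :: real^2^2)$2$1 = 0" "(mat 1 :: real^2^2)$2$2 = 1"
  "adj2 M $1$1 = M$2$2" "adj2 M $1$2 = - M$1$2" "adj2 M $2$1 = - M$2$1" "adj2 M $2$2 = M$1$1"
  by (simp_all add: matrix_matrix_mult_def sum_2 trace_def mat_def adj2_def)

lemma adj2_mult:
  assumes "det M = 1" shows "adj2 M ** M = mat 1" "M ** adj2 M = mat 1"
  using assms by (auto simp: mat2_eq_iff mat2_simps det_2 algebra_simps)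

lemma det_adj2: "det (adj2 M) = det M"
  by (simp add: det_2 mat2_simps algebra_simps)

lemma group_SL2: "group SL2"
proof (rule groupI)
  fix M assume "M \<in> carrier SL2"
  then show "\<exists>N\<in>carrier SL2. N \<otimes>\<^bsub>SL2\<^esub> M = \<one>\<^bsub>SL2\<^esub>"
    by (intro bexI[of _ "adj2 M"]) (simp_all add: carrier_SL2 adj2_mult det_adj2)
qed (auto simp: carrier_SL2 det_mul matrix_mul_assoc)

lemma inv_SL2: "det M = 1 \<Longrightarrow> inv\<^bsub>SL2\<^esub> M = adj2 M"
  by (rule group.inv_equality[OF group_SL2]) (simp_all add: carrier_SL2 adj2_mult det_adj2)

text \<open>\<open>J\<close>, \<open>J ** M\<close> and \<open>J ** N\<close> have trace
  \<open>0\<close>, so the polarised Cayley-Hamilton identity makes \<open>J ** M + M ** J\<close>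
  equal to \<open>J\<close> scaled by \<open>trace M\<close>; and \<open>adj2 M\<close> is
  \<open>trace M\<close> times the identity minus \<open>M\<close>. In \<open>SL2\<close> the
  determinant formula says that \<open>J\<close> is singular exactly when the commutator has trace
  \<open>2\<close>.\<close>

lemma commutator_swaps_adj2:
  fixes M N :: "real^2^2"
  defines "J \<equiv> M ** N - N ** M"
  shows "J ** M = adj2 M ** J" "J ** adj2 M = M ** J" "J ** N = adj2 N ** J" "J ** adj2 N = N ** J"
    and "det J = 2 * det M * det N - trace (M ** N ** adj2 M ** adj2 N)"
  unfolding J_def mat2_eq_iff det_2 by (simp_all add: mat2_simps algebra_simps)

lemma trace_conj:
  fixes J :: "real^2^2"
  assumes "det J \<noteq> 0" "J ** M = N ** J"
  shows "trace N = trace M"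
proof -
  obtain K where K: "J ** K = mat 1" "K ** J = mat 1"
    using assms(1) invertible_det_nz[of J] by (auto simp: invertible_def)
  have "N = J ** M ** K"
    using K assms(2) by (metis matrix_mul_assoc matrix_mul_rid)
  then have "trace N = trace (K ** (J ** M))" by (simp only: trace_mul_sym[of "J ** M"])
  also have "\<dots> = trace M" using K by (metis matrix_mul_assoc matrix_mul_lid)
  finally show ?thesis .
qed

text \<open>The matrix \<open>J\<close> of the two generators intertwines \<open>r\<close> with
  \<open>r\<close> after \<open>flip\<close>, first on letters and then on words. The condition on
  the commutator makes \<open>J\<close> invertible, so the two images are conjugate.\<close>

lemma (in free_group) trace_flip:
  assumes A: "A = {x, y}" and r: "r \<in> hom G SL2"
    and ne: "trace (r (x \<otimes> y \<otimes> inv x \<otimes> inv y)) \<noteq> 2" and g: "g \<in> carrier G"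
  shows "trace (r (flip g)) = trace (r g)"
proof -
  interpret r: group_hom G SL2 r
    using r group_SL2 is_group by (simp add: group_hom_def group_hom_axioms_def)
  have xy: "x \<in> carrier G" "y \<in> carrier G" using A by auto
  have det1: "det (r h) = 1" if "h \<in> carrier G" for h
    using r.hom_closed[OF that] by (simp add: carrier_SL2)
  define J where "J = r x ** r y - r y ** r x"
  note J = commutator_swaps_adj2[of "r x" "r y", folded J_def]
  have fl: "flip (inv z) = z" if "z \<in> A" for z
    using flip_flip[of z] that by (simp add: flip_basis)
  have letter: "J ** r (letter_val G l) = r (flip (letter_val G l)) ** J" if "fst l \<in> A" for l
  proof -
    consider "fst l = x" | "fst l = y" using \<open>fst l \<in> A\<close> A by auto
    then show ?thesis
      using J(1-4) fl[OF that] flip_basis[OF that] xy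
      by cases (simp_all add: letter_val_def inv_SL2 det1)
  qed
  have "J ** r (word_val G w) = r (flip (word_val G w)) ** J" if "w \<in> words A" for w
    using that
  proof (induction w)
    case Nil
    have "flip \<one> = \<one>" using flip_hom hom_one[of flip G G] is_group by blast
    then show ?case by simp
  next
    case (Cons l w)
    have c: "letter_val G l \<in> carrier G" "word_val G w \<in> carrier G"
      using Cons by (auto simp: letter_val_closed word_val_closed words_carrier)
    have "J ** (r (letter_val G l) ** r (word_val G w)) =
        r (flip (letter_val G l)) ** (J ** r (word_val G w))"
      using letter Cons.prems by (simp add: matrix_mul_assoc)
    also have "\<dots> = r (flip (letter_val G l)) ** r (flip (word_val G w)) ** J"
      using Cons by (simp add: matrix_mul_assoc)
    finally show ?case
      using c by (simp add: word_val_Cons hom_mult[OF flip_hom] flip_closed)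
  qed
  then have "J ** r g = r (flip g) ** J"
    using g nf_words word_val_nf by metis
  moreover have "det J \<noteq> 0"
    using ne xy J(5) by (simp add: inv_SL2 det1)
  ultimately show ?thesis by (rule trace_conj[rotated])
qed

text \<open>The axes of \<open>diag_mat t\<close> and \<open>hyp_mat t\<close> are in general position: the projections to
  which the matrices of two letters converge after division by \<open>t\<close> have product \<open>0\<close> only if the
  letters cancel.\<close>

definition diag_mat :: "real \<Rightarrow> real^2^2"
  where "diag_mat t = vector [vector [t, 0], vector [0, 1 / t]]"

definition hyp_mat :: "real \<Rightarrow> real^2^2"
  where "hyp_mat t = vector [vector [(t + 1 / t) / 2, (t - 1 / t) / 2],
    vector [(t - 1 / t) / 2, (t + 1 / t) / 2]]"

lemma det_diag_mat: "t \<noteq> 0 \<Longrightarrow> det (diag_mat t) = 1"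
  and det_hyp_mat: "t \<noteq> 0 \<Longrightarrow> det (hyp_mat t) = 1"
  by (simp_all add: det_2 diag_mat_def hyp_mat_def field_simps)

text \<open>An eigenvector for the eigenvalue \<open>t\<close> of the matrix of the letter; letters
  not over \<open>a\<close> count as letters over the second generator. The matrices are symmetric,
  so the vector of the inverse letter is orthogonal.\<close>

definition attr_vec :: "'a \<Rightarrow> 'a \<times> bool \<Rightarrow> real^2"
  where "attr_vec a l = (if fst l = a then if snd l then vector [1, 0] else vector [0, 1]
    else if snd l then vector [1, 1] else vector [1, -1])"

definition outer :: "real^2 \<Rightarrow> real^2 \<Rightarrow> real^2^2"
  where "outer u v = (\<chi> i j. u$i * v$j)"

lemma trace_outer: "trace (c *\<^sub>R outer u v) = c * (u \<bullet> v)"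
  by (simp add: mat2_simps outer_def inner_vec_def sum_2 algebra_simps)

lemma outer_mult: "outer u v ** outer u' v' = (v \<bullet> u') *\<^sub>R outer u v'"
  by (simp add: mat2_eq_iff mat2_simps outer_def inner_vec_def sum_2 algebra_simps)

lemma scaleR_mat2_mult: "(c *\<^sub>R M) ** (d *\<^sub>R N) = (c * d) *\<^sub>R (M ** N)" for M N :: "real^2^2"
  by (simp add: mat2_eq_iff mat2_simps algebra_simps)

text \<open>A vector on a coordinate axis and one on a diagonal are never orthogonal; otherwise
  orthogonality means that the letters are mutually inverse.\<close>

lemma attr_vec_inner_ne:
  assumes "fst k \<in> {a, b}" "fst l \<in> {a, b}" "l \<noteq> letter_inv k"
  shows "attr_vec a k \<bullet> attr_vec a l \<noteq> 0"
  using assms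
  by (cases k; cases l; cases "snd k"; cases "snd l")
    (auto simp: attr_vec_def inner_vec_def sum_2 letter_inv_def)

lemma attr_vec_self_ne: "attr_vec a l \<bullet> attr_vec a l \<noteq> 0"
  by (auto simp: attr_vec_def inner_vec_def sum_2)

lemma tendsto_mat2_iff:
  fixes f :: "'b \<Rightarrow> real^2^2"
  shows "(f \<longlongrightarrow> M) F \<longleftrightarrow> (\<forall>i j. ((\<lambda>t. f t $ i $ j) \<longlongrightarrow> M $ i $ j) F)"
  by (auto intro: tendsto_vec_nth vec_tendstoI)

lemma tendsto_matrix_mult:
  fixes f g :: "'b \<Rightarrow> real^2^2"
  assumes "(f \<longlongrightarrow> M) F" "(g \<longlongrightarrow> N) F"
  shows "((\<lambda>t. f t ** g t) \<longlongrightarrow> M ** N) F"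
  using assms unfolding tendsto_mat2_iff mat2_simps
  by (auto intro!: tendsto_add tendsto_mult)

lemma tendsto_trace:
  fixes f :: "'b \<Rightarrow> real^2^2"
  assumes "(f \<longlongrightarrow> M) F"
  shows "((\<lambda>t. trace (f t)) \<longlongrightarrow> trace M) F"
  using assms unfolding tendsto_mat2_iff mat2_simps
  by (auto intro!: tendsto_add tendsto_mult)

definition gen_mat :: "'a \<Rightarrow> real \<Rightarrow> 'a \<Rightarrow> real^2^2"
  where "gen_mat a t x = (if x = a then diag_mat t else hyp_mat t)"

lemma det_gen_mat: "t \<noteq> 0 \<Longrightarrow> det (gen_mat a t x) = 1"
  by (simp add: gen_mat_def det_diag_mat det_hyp_mat)

text \<open>The eigenvalue \<open>1 / t\<close> becomes negligible after division by
  \<open>t\<close>, which leaves the orthogonal projection onto the other eigenline.\<close>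

lemma letter_limit:
  "((\<lambda>t. (1 / t) *\<^sub>R letter_val SL2 (gen_mat a t (fst l), snd l)) \<longlongrightarrow>
    (1 / (attr_vec a l \<bullet> attr_vec a l)) *\<^sub>R outer (attr_vec a l) (attr_vec a l)) at_top"
proof -
  have lims: "((\<lambda>t :: real. 1 / (t * t)) \<longlongrightarrow> 0) at_top"
      "((\<lambda>t :: real. (t + 1 / t) / (t * 2)) \<longlongrightarrow> 1 / 2) at_top"
      "((\<lambda>t :: real. (t - 1 / t) / (t * 2)) \<longlongrightarrow> 1 / 2) at_top"
      "((\<lambda>t :: real. - ((t - 1 / t) / (t * 2))) \<longlongrightarrow> - (1 / 2)) at_top"
      "((\<lambda>t :: real. t / t) \<longlongrightarrow> 1) at_top"
    by real_asymp+
  \<comment> \<open>For nonzero \<open>t\<close> the inverse is the adjugate, whose entries have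
    readable limits.\<close>
  have ev: "eventually (\<lambda>t. (1 / t) *\<^sub>R (if snd l then gen_mat a t (fst l) else adj2 (gen_mat a t (fst l))) =
      (1 / t) *\<^sub>R letter_val SL2 (gen_mat a t (fst l), snd l)) at_top"
    using eventually_gt_at_top[of 0] by eventually_elim (simp add: letter_val_def inv_SL2 det_gen_mat)
  have "((\<lambda>t. (1 / t) *\<^sub>R (if snd l then gen_mat a t (fst l) else adj2 (gen_mat a t (fst l)))) \<longlongrightarrow>
    (1 / (attr_vec a l \<bullet> attr_vec a l)) *\<^sub>R outer (attr_vec a l) (attr_vec a l)) at_top"
    using lims unfolding tendsto_mat2_iff forall_2
    by (cases "snd l"; cases "fst l = a")
      (simp_all add: outer_def attr_vec_def inner_vec_def sum_2 gen_mat_def mat2_simps diag_mat_def hyp_mat_def)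
  from Lim_transform_eventually[OF this ev] show ?thesis .
qed

text \<open>A product of rank one matrices keeps only the outermost vectors. The inner products of
  neighbouring vectors become scalar factors, and none of them is zero in a reduced word.\<close>

lemma word_limit:
  assumes "w \<in> words {a, b}" "reduced w" "w \<noteq> []"
  shows "\<exists>c\<noteq>0. ((\<lambda>t. (1 / t ^ length w) *\<^sub>R word_val SL2 (map_word (gen_mat a t) w)) \<longlongrightarrow>
    c *\<^sub>R outer (attr_vec a (hd w)) (attr_vec a (last w))) at_top"
  using assms
proof (induction w)
  case (Cons l w)
  let ?u = "attr_vec a l" and ?f = "\<lambda>t. letter_val SL2 (gen_mat a t (fst l), snd l)"
  let ?g = "\<lambda>t. word_val SL2 (map_word (gen_mat a t) w)"
  note L = letter_limit[of a l]
  show ?case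
  proof (cases "w = []")
    case True
    then show ?thesis
      using L attr_vec_self_ne[of a l] by (intro exI[of _ "1 / (?u \<bullet> ?u)"]) (simp add: word_val_Cons)
  next
    case False
    then obtain c where c: "c \<noteq> 0" and lim: "((\<lambda>t. (1 / t ^ length w) *\<^sub>R ?g t) \<longlongrightarrow>
        c *\<^sub>R outer (attr_vec a (hd w)) (attr_vec a (last w))) at_top"
      using Cons by (auto simp: reduced_Cons)
    have "?u \<bullet> attr_vec a (hd w) \<noteq> 0"
      using False Cons.prems words_hd[OF _ False, of "{a, b}"]
      by (intro attr_vec_inner_ne[of _ a b]) (simp_all add: reduced_Cons)
    then have "1 / (?u \<bullet> ?u) * c * (?u \<bullet> attr_vec a (hd w)) \<noteq> 0"
      using c attr_vec_self_ne[of a l] by simp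
    moreover have "((\<lambda>t. ((1 / t) *\<^sub>R ?f t) ** ((1 / t ^ length w) *\<^sub>R ?g t)) \<longlongrightarrow>
        ((1 / (?u \<bullet> ?u)) *\<^sub>R outer ?u ?u) ** (c *\<^sub>R outer (attr_vec a (hd w)) (attr_vec a (last w)))) at_top"
      by (rule tendsto_matrix_mult[OF L lim])
    ultimately show ?thesis
      using False
      by (intro exI[of _ "1 / (?u \<bullet> ?u) * c * (?u \<bullet> attr_vec a (hd w))"])
        (simp add: word_val_Cons scaleR_mat2_mult outer_mult mult_ac)
  qed
qed simp

section \<open>Growth of traces and cyclic length\<close>

definition (in free_group) rep :: "'a \<Rightarrow> real \<Rightarrow> 'a \<Rightarrow> real^2^2"
  where "rep a t = extend SL2 (gen_mat a t)"

lemma (in free_group) rep_hom: "t \<noteq> 0 \<Longrightarrow> rep a t \<in> hom G SL2"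
  unfolding rep_def by (rule extend_hom[OF group_SL2]) (auto simp: carrier_SL2 det_gen_mat)

lemma (in free_group) trace_rep_conj:
  assumes "t \<noteq> 0" "c \<in> carrier G" "h \<in> carrier G"
  shows "trace (rep a t (h \<otimes> c \<otimes> inv h)) = trace (rep a t c)"
proof -
  interpret r: group_hom G SL2 "rep a t"
    using rep_hom[OF assms(1)] group_SL2 is_group by (simp add: group_hom_def group_hom_axioms_def)
  have d: "det (rep a t h) = 1" using r.hom_closed[OF assms(3)] by (simp add: carrier_SL2)
  have "trace (rep a t (h \<otimes> c \<otimes> inv h)) = trace (adj2 (rep a t h) ** (rep a t h ** rep a t c))"
    using assms d by (simp add: inv_SL2 trace_mul_sym[of _ "adj2 (rep a t h)"])
  also have "\<dots> = trace (rep a t c)" using d by (simp add: matrix_mul_assoc adj2_mult)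
  finally show ?thesis .
qed

text \<open>The limiting rank one matrix has as trace a nonzero multiple of the inner product of the
  vectors of the first and the last letter, and these letters do not cancel cyclically.\<close>

lemma (in free_group) trace_rep_limit:
  assumes A: "A = {a, b}" and "c \<in> carrier G" "cyc_reduced (nf c)"
  shows "\<exists>\<kappa>\<noteq>0. ((\<lambda>t. trace (rep a t c) / t ^ len c) \<longlongrightarrow> \<kappa>) at_top"
proof (cases "nf c = []")
  case True
  then show ?thesis
    by (intro exI[of _ 2]) (simp add: rep_def extend_def len_def mat2_simps)
next
  case False
  obtain \<kappa> where "\<kappa> \<noteq> 0" and "((\<lambda>t. (1 / t ^ len c) *\<^sub>R rep a t c) \<longlongrightarrow>
      \<kappa> *\<^sub>R outer (attr_vec a (hd (nf c))) (attr_vec a (last (nf c)))) at_top"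
    using word_limit[of "nf c" a b] assms False nf_words reduced_nf
    unfolding rep_def extend_def len_def by auto
  from tendsto_trace[OF this(2)]
  have "((\<lambda>t. trace (rep a t c) / t ^ len c) \<longlongrightarrow>
      \<kappa> * (attr_vec a (hd (nf c)) \<bullet> attr_vec a (last (nf c)))) at_top"
    unfolding trace_outer by (simp add: mat2_simps add_divide_distrib)
  moreover have "attr_vec a (last (nf c)) \<bullet> attr_vec a (hd (nf c)) \<noteq> 0"
    using False assms(3) A words_hd[OF nf_words[OF assms(2)] False] words_last[OF nf_words[OF assms(2)] False]
    by (intro attr_vec_inner_ne[of _ a b]) (simp_all add: cyc_reduced_def)
  ultimately show ?thesis
    using \<open>\<kappa> \<noteq> 0\<close>
    by (intro exI[of _ "\<kappa> * (attr_vec a (hd (nf c)) \<bullet> attr_vec a (last (nf c)))"]) (simp add: inner_commute)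
qed

text \<open>If \<open>c'\<close> were longer, dividing the common trace by the larger power of
  \<open>t\<close> would give the limit \<open>0\<close> as well as a nonzero limit.\<close>

lemma (in free_group) len_le_of_trace_eq:
  assumes A: "A = {a, b}" and c: "c \<in> carrier G" "cyc_reduced (nf c)"
    and c': "c' \<in> carrier G" "cyc_reduced (nf c')"
    and ev: "eventually (\<lambda>t. trace (rep a t c) = trace (rep a t c')) at_top"
  shows "len c' \<le> len c"
proof (rule ccontr)
  assume "\<not> len c' \<le> len c"
  then obtain k where k: "len c' = len c + Suc k" by (metis add_Suc_right less_imp_Suc_add not_le)
  obtain \<kappa> \<kappa>' where "((\<lambda>t. trace (rep a t c) / t ^ len c) \<longlongrightarrow> \<kappa>) at_top"
    and \<kappa>': "\<kappa>' \<noteq> 0" "((\<lambda>t. trace (rep a t c') / t ^ len c') \<longlongrightarrow> \<kappa>') at_top"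
    using trace_rep_limit[OF A c] trace_rep_limit[OF A c'] by blast
  moreover have "((\<lambda>t :: real. 1 / t ^ Suc k) \<longlongrightarrow> 0) at_top" by real_asymp
  ultimately have "((\<lambda>t. trace (rep a t c) / t ^ len c * (1 / t ^ Suc k)) \<longlongrightarrow> \<kappa> * 0) at_top"
    by (intro tendsto_mult)
  moreover have "eventually (\<lambda>t. trace (rep a t c) / t ^ len c * (1 / t ^ Suc k) =
      trace (rep a t c') / t ^ len c') at_top"
    using ev by eventually_elim (simp add: k power_add)
  ultimately have "((\<lambda>t. trace (rep a t c') / t ^ len c') \<longlongrightarrow> \<kappa> * 0) at_top"
    by (rule Lim_transform_eventually)
  with \<kappa>' have "\<kappa>' = \<kappa> * 0" by (intro tendsto_unique[of at_top]) auto
  then show False using \<kappa>' by simp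
qed

section \<open>Bases of the free group of rank two\<close>

lemma (in group) conj_hom:
  assumes "h \<in> hom G G" "r \<in> carrier G"
  shows "(\<lambda>g. r \<otimes> h g \<otimes> inv r) \<in> hom G G"
proof (rule homI)
  fix x y assume xy: "x \<in> carrier G" "y \<in> carrier G"
  then have c: "h x \<in> carrier G" "h y \<in> carrier G" using assms hom_in_carrier by metis+
  have "inv r \<otimes> (r \<otimes> z) = z" if "z \<in> carrier G" for z
    using that assms by (simp add: m_assoc[symmetric])
  then show "r \<otimes> h (x \<otimes> y) \<otimes> inv r = r \<otimes> h x \<otimes> inv r \<otimes> (r \<otimes> h y \<otimes> inv r)"
    using c assms xy by (simp add: hom_mult[OF assms(1)] m_assoc)
qed (use assms hom_in_carrier in fastforce)

context free_group begin

text \<open>Homomorphisms to the integers are determined by their values on a basis. One basis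
  element would make any two of them proportional; three would give three independent ones, each
  determined by two values.\<close>

lemma rank_two:
  assumes A: "A = {a, b}" "a \<noteq> b" and B: "free_basis G B"
  obtains x y where "x \<noteq> y" "B = {x, y}"
proof -
  interpret B: free_group G B using B by unfold_locales
  have ab: "a \<in> carrier G" "b \<in> carrier G" using A by auto
  have e: "expo a a = 1" "expo a b = 0" "expo b a = 0" "expo b b = 1"
    using A(2) expo_basis[of a] expo_basis[of b] unfolding A(1) by simp_all
  have not_sub: "\<not> B \<subseteq> {x}" for x
  proof
    assume sub: "B \<subseteq> {x}"
    \<comment> \<open>The exponent sums are proportional when everything is generated by
      \<open>x\<close>. The term with coefficient \<open>0\<close> fills the third place of the
      combination.\<close>
    have "expo a x * expo b g + - expo b x * expo a g + 0 * expo a g = 0" if "g \<in> carrier G" for g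
      by (rule B.hom_combination_eq_0[OF expo_hom expo_hom expo_hom _ that]) (use sub in auto)
    from this[OF ab(2)] have "expo a x = 0" by (simp add: e)
    then have "1 * expo a g + 0 * expo a g + 0 * expo a g = 0" if "g \<in> carrier G" for g
      by (intro B.hom_combination_eq_0[OF expo_hom expo_hom expo_hom _ that]) (use sub in auto)
    from this[OF ab(1)] show False by (simp add: e)
  qed
  have two: "z = x \<or> z = y" if xyz: "x \<in> B" "y \<in> B" "z \<in> B" "x \<noteq> y" for x y z
  proof (rule ccontr)
    assume ne: "\<not> (z = x \<or> z = y)"
    define f g h where "f = B.expo x" and "g = B.expo y" and "h = B.expo z"
    have comb: "c\<^sub>1 * f u + c\<^sub>2 * g u + c\<^sub>3 * h u = 0"
      if "c\<^sub>1 * f a + c\<^sub>2 * g a + c\<^sub>3 * h a = 0" "c\<^sub>1 * f b + c\<^sub>2 * g b + c\<^sub>3 * h b = 0"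
        "u \<in> carrier G" for c\<^sub>1 c\<^sub>2 c\<^sub>3 u
      unfolding f_def g_def h_def
      by (rule hom_combination_eq_0[OF B.expo_hom B.expo_hom B.expo_hom _ that(3)])
        (use A that(1,2) in \<open>auto simp: f_def g_def h_def\<close>)
    have indep: "c\<^sub>1 = 0 \<and> c\<^sub>2 = 0 \<and> c\<^sub>3 = 0"
      if "c\<^sub>1 * f a + c\<^sub>2 * g a + c\<^sub>3 * h a = 0" "c\<^sub>1 * f b + c\<^sub>2 * g b + c\<^sub>3 * h b = 0" for c\<^sub>1 c\<^sub>2 c\<^sub>3
      using comb[OF that, of x] comb[OF that, of y] comb[OF that, of z] xyz ne
      by (simp add: f_def g_def h_def B.expo_basis)
    \<comment> \<open>The coefficients form the cross product of the vectors of values at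
      \<open>a\<close> and \<open>b\<close>, which is orthogonal to both.\<close>
    have c3: "f a * g b - f b * g a = 0"
      using indep[of "g a * h b - g b * h a" "f b * h a - f a * h b" "f a * g b - f b * g a"]
      by (simp add: algebra_simps)
    \<comment> \<open>Since the minor in \<open>c3\<close> is zero, \<open>(- g a, f a, 0)\<close>
      and \<open>(- g b, f b, 0)\<close> are relations too.\<close>
    have "f a = 0" "f b = 0"
      using indep[of "- g a" "f a" 0] indep[of "- g b" "f b" 0] c3 by (simp_all add: algebra_simps)
    then show False using indep[of 1 0 0] by simp
  qed
  obtain x where x: "x \<in> B" using not_sub[of a] by auto
  obtain y where y: "y \<in> B" "y \<noteq> x" using not_sub[of x] by auto
  have "B = {x, y}" using two[of x y] x y by blast
  with y(2) show ?thesis using that by metis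
qed

text \<open>The growth bound replaces \<open>p\<close> and \<open>q\<close> by a single
  \<open>r\<close>. Then \<open>\<theta>\<close> agrees on the basis with the identity or
  \<open>flip\<close> followed by conjugation, hence everywhere.\<close>

lemma hom_conj_of_letters:
  assumes A: "A = {a, b}" "a \<noteq> b" and \<theta>: "\<theta> \<in> hom G G"
    and a: "p \<in> carrier G" "\<theta> a = p \<otimes> letter_val G (a, s) \<otimes> inv p"
    and b: "q \<in> carrier G" "\<theta> b = q \<otimes> letter_val G (b, s) \<otimes> inv q"
    and bound: "\<And>n :: nat. len (\<theta> (a \<otimes> b) [^] n) \<le> 2 * n + C"
  shows "\<exists>r\<in>carrier G. \<forall>g\<in>carrier G. \<theta> g = r \<otimes> (if s then g else flip g) \<otimes> inv r"
proof -
  have "a \<in> carrier G" "b \<in> carrier G" using A by auto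
  then have "\<theta> (a \<otimes> b) = \<theta> a \<otimes> \<theta> b" by (rule hom_mult[OF \<theta>])
  then obtain r where r: "r \<in> carrier G" "\<theta> a = r \<otimes> letter_val G (a, s) \<otimes> inv r"
      "\<theta> b = r \<otimes> letter_val G (b, s) \<otimes> inv r"
    using common_conjugator[of "(a, s)" "(b, s)" p q C] A a b bound by auto
  let ?\<sigma> = "\<lambda>g. if s then g else flip g"
  have "?\<sigma> \<in> hom G G" using flip_hom by (cases s) (auto simp: hom_def)
  moreover have "\<theta> x = r \<otimes> ?\<sigma> x \<otimes> inv r" if "x \<in> A" for x
    using that r flip_basis[OF that] A(1) by (cases s) auto
  ultimately have "\<theta> g = r \<otimes> ?\<sigma> g \<otimes> inv r" if "g \<in> carrier G" for g
    using hom_eqI[OF is_group \<theta> conj_hom[OF _ r(1)] _ that] by blast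
  then show ?thesis using r(1) by blast
qed

lemma letter_of_len_le_one:
  assumes "c \<in> carrier G" "len c \<le> 1" "c \<noteq> \<one>"
  obtains l where "fst l \<in> A" "c = letter_val G l"
proof -
  have "nf c \<noteq> []" using assms nf_Nil_iff by blast
  then obtain l where l: "nf c = [l]" using assms(2) by (cases "nf c") (auto simp: len_def)
  then have "fst l \<in> A" using nf_words[OF assms(1)] by simp
  moreover have "c = letter_val G l"
    using word_val_nf[OF assms(1)] l \<open>fst l \<in> A\<close> by (simp add: word_val_Cons letter_val_closed)
  ultimately show ?thesis using that by blast
qed

lemma expo_letter_val:
  "fst l \<in> A \<Longrightarrow> expo x (letter_val G l) = (if fst l = x then if snd l then 1 else - 1 else 0)"
  by (auto simp: letter_val_def expo_basis expo_inv)

text \<open>The trace of a nontrivial element grows like a positive power of \<open>t\<close>.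
  Applied to a commutator, this provides the condition of \<open>trace_flip\<close> for large
  \<open>t\<close>.\<close>

lemma eventually_trace_ne_2:
  assumes A: "A = {a, b}" and g: "g \<in> carrier G" "g \<noteq> \<one>"
  shows "eventually (\<lambda>t. trace (rep a t g) \<noteq> 2) at_top"
proof -
  obtain c h where c: "c \<in> carrier G" "h \<in> carrier G" "g = h \<otimes> c \<otimes> inv h" "cyc_reduced (nf c)"
    using exists_cyc_reduced_conj[OF g(1)] .
  have "c \<noteq> \<one>" using c g by auto
  then obtain k where k: "len c = Suc k" using len_eq_0_iff[OF c(1)] not0_implies_Suc by blast
  obtain \<kappa> where \<kappa>: "\<kappa> \<noteq> 0" "((\<lambda>t. trace (rep a t c) / t ^ len c) \<longlongrightarrow> \<kappa>) at_top"
    using trace_rep_limit[OF A c(1,4)] by blast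
  have "((\<lambda>t :: real. 2 / t ^ Suc k) \<longlongrightarrow> 0) at_top" by real_asymp
  from tendsto_diff[OF \<kappa>(2) this[folded k]]
  have "((\<lambda>t. trace (rep a t c) / t ^ len c - 2 / t ^ len c) \<longlongrightarrow> \<kappa>) at_top" by simp
  from tendsto_imp_eventually_ne[OF this \<kappa>(1)] eventually_gt_at_top[of 0]
  show ?thesis by eventually_elim (use c in \<open>auto simp: trace_rep_conj\<close>)
qed

text \<open>Equal traces show that the flip of \<open>B\<close> does not raise cyclic length over
  \<open>{a, b}\<close>, and it negates exponent sums. So \<open>a\<close> and \<open>b\<close> go
  to conjugates of their inverses, and the cyclic length of the image of
  \<open>a \<otimes> b\<close> yields a common conjugator.\<close>

lemma flip_inner:
  assumes A: "A = {a, b}" "a \<noteq> b" and B: "free_basis G B"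
  shows "\<exists>r\<in>carrier G. \<forall>g\<in>carrier G. free_group.flip G B g = r \<otimes> flip g \<otimes> inv r"
proof -
  interpret B: free_group G B using B by unfold_locales
  obtain x y where xy: "x \<noteq> y" "B = {x, y}" using rank_two[OF A B] .
  have ab: "a \<in> carrier G" "b \<in> carrier G" using A by auto
  have xyc: "x \<in> carrier G" "y \<in> carrier G" using xy by auto
  \<comment> \<open>Over \<open>B\<close> the commutator is a nonempty reduced word, hence
    nontrivial.\<close>
  have "B.nf (word_val G [(x, True), (y, True), (x, False), (y, False)]) \<noteq> []"
    using xy by (subst B.nf_word_val) (auto simp: reduced_Cons letter_inv_def)
  then have "x \<otimes> y \<otimes> inv x \<otimes> inv y \<noteq> \<one>"
    using xyc by (auto simp: word_val_Cons m_assoc)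
  then have ev: "eventually (\<lambda>t. trace (rep a t (x \<otimes> y \<otimes> inv x \<otimes> inv y)) \<noteq> 2) at_top"
    using xyc by (intro eventually_trace_ne_2[OF A(1)]) auto
  have short: "\<exists>c h. c \<in> carrier G \<and> h \<in> carrier G \<and> B.flip g = h \<otimes> c \<otimes> inv h \<and> len c \<le> len g"
    if g: "g \<in> carrier G" "cyc_reduced (nf g)" for g
  proof -
    obtain c h where c: "c \<in> carrier G" "h \<in> carrier G" "B.flip g = h \<otimes> c \<otimes> inv h" "cyc_reduced (nf c)"
      using exists_cyc_reduced_conj[OF B.flip_closed[OF g(1)]] .
    from ev eventually_gt_at_top[of 0]
    have "eventually (\<lambda>t. trace (rep a t g) = trace (rep a t c)) at_top"
    proof eventually_elim
      case (elim t)
      have "trace (rep a t (B.flip g)) = trace (rep a t g)"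
        using elim by (intro B.trace_flip[OF xy(2) rep_hom _ g(1)]) auto
      then show ?case using c elim by (simp add: trace_rep_conj)
    qed
    then show ?thesis using len_le_of_trace_eq[OF A(1) g c(1,4)] c by blast
  qed
  \<comment> \<open>Both sides are homomorphisms, so it suffices to compare them on
    \<open>B\<close>, where \<open>B.flip\<close> is inversion.\<close>
  have expo_flip: "expo z (B.flip g) = - expo z g" if "g \<in> carrier G" for z g
  proof (rule B.hom_eqI[of integer_group "\<lambda>g. expo z (B.flip g)" "\<lambda>g. - expo z g"])
    show "(\<lambda>g. expo z (B.flip g)) \<in> hom G integer_group"
      using hom_compose[OF B.flip_hom expo_hom] by (simp add: hom_def compose_def Pi_iff B.flip_closed expo_mult hom_mult[OF B.flip_hom])
    show "(\<lambda>g. - expo z g) \<in> hom G integer_group"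
      by (auto simp: hom_def expo_mult)
  qed (use that in \<open>auto simp: B.flip_basis expo_inv\<close>)
  have letter: "\<exists>p\<in>carrier G. B.flip u = p \<otimes> letter_val G (u, False) \<otimes> inv p" if u: "u \<in> A" for u
  proof -
    have "cyc_reduced (nf u)" using u by (simp add: nf_basis cyc_reduced_def reduced_Cons letter_inv_def)
    then obtain c h where c: "c \<in> carrier G" "h \<in> carrier G" "B.flip u = h \<otimes> c \<otimes> inv h" "len c \<le> 1"
      using short[of u] u by (auto simp: len_basis)
    have e: "expo u c = - 1"
      using expo_flip[of u u] c u by (simp add: expo_basis expo_conj)
    have "expo u \<one> = 0" using expo_mult[of \<one> \<one> u] by simp
    with e have "c \<noteq> \<one>" by auto
    then obtain l where l: "fst l \<in> A" "c = letter_val G l"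
      using letter_of_len_le_one[OF c(1,4)] by blast
    \<comment> \<open>Among all letters only the inverse of \<open>u\<close> has exponent sum
      \<open>-1\<close> in \<open>u\<close>.\<close>
    have "l = (u, False)" using e l by (auto simp: expo_letter_val prod_eq_iff split: if_splits)
    then show ?thesis using l c by blast
  qed
  obtain p q where pq: "p \<in> carrier G" "B.flip a = p \<otimes> letter_val G (a, False) \<otimes> inv p"
    "q \<in> carrier G" "B.flip b = q \<otimes> letter_val G (b, False) \<otimes> inv q"
    using letter[of a] letter[of b] A by auto
  have "nf (word_val G [(a, True), (b, True)]) = [(a, True), (b, True)]"
    using A by (intro nf_word_val) (auto simp: reduced_Cons letter_inv_def)
  then have nfab: "nf (a \<otimes> b) = [(a, True), (b, True)]"
    using ab by (simp add: word_val_Cons)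
  then have "cyc_reduced (nf (a \<otimes> b))" using A by (simp add: cyc_reduced_def reduced_Cons letter_inv_def)
  then obtain c h where c: "c \<in> carrier G" "h \<in> carrier G" "B.flip (a \<otimes> b) = h \<otimes> c \<otimes> inv h" "len c \<le> 2"
    using short[of "a \<otimes> b"] ab nfab by (auto simp: len_def)
  have "len (B.flip (a \<otimes> b) [^] n) \<le> 2 * n + 2 * len h" for n :: nat
    using pow_bound_of_conj[OF c(1,2), of n] mult_le_mono1[OF c(4), of n] unfolding c(3) by linarith
  from hom_conj_of_letters[OF A B.flip_hom pq this] show ?thesis by simp
qed

end

section \<open>Visual metrics\<close>

lemma longest_common_prefix_split:
  obtains u v w where "u = longest_common_prefix xs ys" "xs = u @ v" "ys = u @ w"
    "v = [] \<or> w = [] \<or> hd v \<noteq> hd w"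
proof -
  obtain u where u: "u = longest_common_prefix xs ys" by blast
  obtain v w where vw: "xs = u @ v" "ys = u @ w"
    using longest_common_prefix_prefix1[of xs ys] longest_common_prefix_prefix2[of xs ys]
    unfolding u[symmetric] by (meson prefixE)
  have "v = [] \<or> w = [] \<or> hd v \<noteq> hd w"
  proof (rule ccontr)
    assume "\<not> ?thesis"
    then have "v = hd v # tl v" "w = hd v # tl w" by (metis list.collapse)+
    then have "xs = (u @ [hd v]) @ tl v" "ys = (u @ [hd v]) @ tl w" using vw by simp_all
    then have "prefix (u @ [hd v]) xs" "prefix (u @ [hd v]) ys" by (metis prefixI)+
    then have "prefix (u @ [hd v]) u" unfolding u by (rule longest_common_prefix_max_prefix)
    then show False using prefix_length_le by fastforce
  qed
  with u vw show ?thesis using that by blast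
qed

text \<open>Two prefixes of \<open>ys\<close> are comparable, and the shorter one is a prefix of
  both \<open>xs\<close> and \<open>zs\<close>.\<close>

lemma longest_common_prefix_ultrametric:
  "min (length (longest_common_prefix xs ys)) (length (longest_common_prefix ys zs))
    \<le> length (longest_common_prefix xs zs)"
proof -
  let ?p = "longest_common_prefix xs ys" and ?q = "longest_common_prefix ys zs"
  have pq: "prefix ?p xs" "prefix ?p ys" "prefix ?q ys" "prefix ?q zs"
    by (simp_all add: longest_common_prefix_prefix1 longest_common_prefix_prefix2)
  then consider "prefix ?p ?q" | "prefix ?q ?p" using prefix_same_cases by blast
  then show ?thesis
  proof cases
    case 1
    then have "prefix ?p (longest_common_prefix xs zs)"
      using pq prefix_order.trans by (blast intro: longest_common_prefix_max_prefix)
    from prefix_length_le[OF this] show ?thesis by (simp add: min_le_iff_disj)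
  next
    case 2
    then have "prefix ?q (longest_common_prefix xs zs)"
      using pq prefix_order.trans by (blast intro: longest_common_prefix_max_prefix)
    from prefix_length_le[OF this] show ?thesis by (simp add: min_le_iff_disj)
  qed
qed

context free_group begin

text \<open>Beyond the longest common prefix the remainders do not cancel, so the distance is the
  sum of their lengths, and the prefix alone is left, counted twice and then halved.\<close>

lemma gromov_prod_one:
  assumes "g \<in> carrier G" "h \<in> carrier G"
  shows "gromov_prod G A \<one> g h = real (length (longest_common_prefix (nf g) (nf h)))"
proof -
  obtain u v w where u: "u = longest_common_prefix (nf g) (nf h)"
    and vw: "nf g = u @ v" "nf h = u @ w" "v = [] \<or> w = [] \<or> hd v \<noteq> hd w"
    by (rule longest_common_prefix_split)
  have words: "u \<in> words A" "v \<in> words A" "w \<in> words A"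
    using nf_words[OF assms(1)] nf_words[OF assms(2)] vw by auto
  then have closed: "word_val G u \<in> carrier G" "word_val G v \<in> carrier G" "word_val G w \<in> carrier G"
    by (auto intro: word_val_closed words_carrier)
  have "g = word_val G u \<otimes> word_val G v" "h = word_val G u \<otimes> word_val G w"
    using word_val_nf[OF assms(1)] word_val_nf[OF assms(2)] vw words
    by (simp_all add: word_val_append words_carrier)
  moreover have "inv (word_val G u) \<otimes> (word_val G u \<otimes> z) = z" if "z \<in> carrier G" for z
    using that closed by (simp add: m_assoc[symmetric])
  ultimately have "inv g \<otimes> h = word_val G (word_inv v @ w)"
    using closed words by (simp add: inv_mult_group m_assoc word_val_append word_val_inv words_carrier)
  moreover have "reduced (word_inv v @ w)"
    using reduced_nf[OF assms(1)] reduced_nf[OF assms(2)] vw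
    by (auto simp: reduced_append last_word_inv)
  ultimately have "nf (inv g \<otimes> h) = word_inv v @ w"
    using words by (simp add: nf_word_val)
  then have "len (inv g \<otimes> h) = length v + length w" by (simp add: len_def)
  moreover have "len g = length u + length v" "len h = length u + length w"
    by (simp_all add: len_def vw)
  ultimately show ?thesis
    using assms by (simp add: gromov_prod_def word_dist_eq_len u[symmetric])
qed

text \<open>At the base point \<open>\<one>\<close> the Gromov product is a prefix length. Hence
  \<open>visual_rho\<close> satisfies even the ultrametric inequality and is itself a visual metric,
  with \<open>T = 1\<close>.\<close>

lemma visual_rho_visual_metric:
  assumes "\<gamma> > 0"
  shows "(\<lambda>g h. if g \<in> carrier G \<and> h \<in> carrier G then visual_rho G A \<one> \<gamma> g h else 0)
    \<in> visual_metrics G A \<one> \<gamma> 1" (is "?d \<in> _")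
proof -
  have comm: "longest_common_prefix xs ys = longest_common_prefix ys xs" for xs ys :: "('a \<times> bool) list"
    by (induction xs ys rule: longest_common_prefix.induct) auto
  have "Metric_space (carrier G) ?d"
  proof
    fix x y z assume xyz: "x \<in> carrier G" "y \<in> carrier G" "z \<in> carrier G"
    have "min (gromov_prod G A \<one> x y) (gromov_prod G A \<one> y z) \<le> gromov_prod G A \<one> x z"
      using longest_common_prefix_ultrametric[of "nf x" "nf y" "nf z"] xyz
      by (simp add: gromov_prod_one)
    then consider "gromov_prod G A \<one> x y \<le> gromov_prod G A \<one> x z"
      | "gromov_prod G A \<one> y z \<le> gromov_prod G A \<one> x z" by linarith
    then have "exp (- \<gamma> * gromov_prod G A \<one> x z) \<le>
        exp (- \<gamma> * gromov_prod G A \<one> x y) + exp (- \<gamma> * gromov_prod G A \<one> y z)"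
    proof cases
      case 1
      then have "exp (- \<gamma> * gromov_prod G A \<one> x z) \<le> exp (- \<gamma> * gromov_prod G A \<one> x y)"
        using assms by simp
      then show ?thesis by (simp add: add_increasing2)
    next
      case 2
      then have "exp (- \<gamma> * gromov_prod G A \<one> x z) \<le> exp (- \<gamma> * gromov_prod G A \<one> y z)"
        using assms by simp
      then show ?thesis by (simp add: add_increasing)
    qed
    then show "?d x z \<le> ?d x y + ?d y z"
      using xyz by (auto simp: visual_rho_def)
  qed (auto simp: visual_rho_def gromov_prod_one comm)
  then show ?thesis by (simp add: visual_metrics_def)
qed

text \<open>Bounded distortion of lengths bounds the drop in Gromov products, so
  \<open>visual_rho\<close> grows by at most a constant factor. Each passage between
  \<open>d\<close> and \<open>visual_rho\<close> costs a factor \<open>T\<close>.\<close>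

lemma lipschitz_of_rough_isometry:
  assumes \<phi>: "\<phi> \<in> hom G G" "inj_on \<phi> (carrier G)"
    and rough: "\<And>g. g \<in> carrier G \<Longrightarrow> len (\<phi> g) \<le> len g + C" "\<And>g. g \<in> carrier G \<Longrightarrow> len g \<le> len (\<phi> g) + C"
    and p: "p \<in> carrier G" and "\<gamma> > 0" "T \<ge> 1" and d: "d \<in> visual_metrics G A p \<gamma> T"
  shows "lipschitz_condition (carrier G) d \<phi>"
proof -
  \<comment> \<open>Each of two distances from \<open>p\<close> drops by at most
    \<open>2 * len p + C\<close>, and the distance between the points grows by at most
    \<open>C\<close>; half of the total is at most \<open>D\<close>.\<close>
  define D where "D = 2 * len p + 2 * C"
  have gp: "gromov_prod G A p g h - D \<le> gromov_prod G A p (\<phi> g) (\<phi> h)"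
    if "g \<in> carrier G" "h \<in> carrier G" for g h
  proof -
    have shift: "len (inv p \<otimes> x) \<le> len (inv p \<otimes> \<phi> x) + 2 * len p + C" if x: "x \<in> carrier G" for x
    proof -
      have "len (inv p \<otimes> x) \<le> len x + len p" using len_mult[of "inv p" x] x p by (simp add: len_inv)
      also have "len x \<le> len (\<phi> x) + C" using rough x by simp
      also have "len (\<phi> x) \<le> len p + len (inv p \<otimes> \<phi> x)"
        using len_mult[of p "inv p \<otimes> \<phi> x"] hom_in_carrier[OF \<phi>(1) x] p by (simp add: m_assoc[symmetric])
      finally show ?thesis by simp
    qed
    interpret group_hom G G \<phi> using \<phi> is_group by (simp add: group_hom_def group_hom_axioms_def)
    have "len (inv (\<phi> g) \<otimes> \<phi> h) \<le> len (inv g \<otimes> h) + C"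
      using rough(1)[of "inv g \<otimes> h"] that by simp
    then have "real (len (inv (\<phi> g) \<otimes> \<phi> h)) \<le> len (inv g \<otimes> h) + C"
      "real (len (inv p \<otimes> g)) \<le> len (inv p \<otimes> \<phi> g) + 2 * len p + C"
      "real (len (inv p \<otimes> h)) \<le> len (inv p \<otimes> \<phi> h) + 2 * len p + C"
      using shift[OF that(1)] shift[OF that(2)] by linarith+
    then show ?thesis
      using that p hom_in_carrier[OF \<phi>(1)]
      unfolding gromov_prod_def D_def by (simp add: word_dist_eq_len field_simps)
  qed
  have "d (\<phi> g) (\<phi> h) \<le> T * T * exp (\<gamma> * D) * d g h" if gh: "g \<in> carrier G" "h \<in> carrier G" for g h
  proof (cases "g = h")
    case True
    have "Metric_space (carrier G) d" using d by (simp add: visual_metrics_def)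
    then have "d x x = 0" if "x \<in> carrier G" for x
      using that Metric_space.zero by fastforce
    then show ?thesis using True gh hom_in_carrier[OF \<phi>(1)] by simp
  next
    case False
    then have ne: "\<phi> g \<noteq> \<phi> h" using gh \<phi>(2) by (auto dest: inj_onD)
    have "\<phi> g \<in> carrier G" "\<phi> h \<in> carrier G" using gh hom_in_carrier[OF \<phi>(1)] by auto
    then have "d (\<phi> g) (\<phi> h) \<le> T * exp (- \<gamma> * gromov_prod G A p (\<phi> g) (\<phi> h))"
      using d ne by (auto simp: visual_metrics_def visual_rho_def)
    also have "\<dots> \<le> T * exp (\<gamma> * D - \<gamma> * gromov_prod G A p g h)"
    proof -
      have "\<gamma> * gromov_prod G A p g h - \<gamma> * D \<le> \<gamma> * gromov_prod G A p (\<phi> g) (\<phi> h)"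
        using mult_left_mono[OF gp[OF gh], of \<gamma>] \<open>\<gamma> > 0\<close> by (simp add: right_diff_distrib)
      then show ?thesis using \<open>T \<ge> 1\<close> by simp
    qed
    also have "\<dots> = T * T * exp (\<gamma> * D) * (1 / T * exp (- \<gamma> * gromov_prod G A p g h))"
      using \<open>T \<ge> 1\<close> by (simp add: exp_diff exp_minus field_simps)
    also have "\<dots> \<le> T * T * exp (\<gamma> * D) * d g h"
      using d gh False \<open>T \<ge> 1\<close>
      by (intro mult_left_mono) (auto simp: visual_metrics_def visual_rho_def)
    finally show ?thesis .
  qed
  moreover have "T * T * exp (\<gamma> * D) > 0" using \<open>T \<ge> 1\<close> by simp
  ultimately show ?thesis unfolding lipschitz_condition_def by blast
qed

text \<open>The condition is tested on the neighbours \<open>g\<close> and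
  \<open>g \<otimes> x\<close>. Their Gromov product is at least \<open>len g - 1\<close>, that of
  their images is at most \<open>len (\<phi> g)\<close>, and logarithms turn the Lipschitz constant
  into an additive one.\<close>

lemma len_le_of_lipschitz:
  assumes \<phi>: "\<phi> \<in> hom G G" "inj_on \<phi> (carrier G)" and x: "x \<in> A"
    and lip: "lipschitz_condition (carrier G)
      (\<lambda>g h. if g \<in> carrier G \<and> h \<in> carrier G then visual_rho G A \<one> 1 g h else 0) \<phi>"
  shows "\<exists>C. \<forall>g\<in>carrier G. len g \<le> len (\<phi> g) + C"
proof -
  obtain K where K: "K > 0" and le: "\<And>g h. g \<in> carrier G \<Longrightarrow> h \<in> carrier G \<Longrightarrow>
      visual_rho G A \<one> 1 (\<phi> g) (\<phi> h) \<le> K * visual_rho G A \<one> 1 g h"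
    using lip hom_in_carrier[OF \<phi>(1)] unfolding lipschitz_condition_def by force
  interpret group_hom G G \<phi> using \<phi> is_group by (simp add: group_hom_def group_hom_axioms_def)
  have "len g \<le> len (\<phi> g) + nat \<lceil>\<bar>ln K\<bar> + 1\<rceil>" if g: "g \<in> carrier G" for g
  proof -
    let ?h = "g \<otimes> x"
    have xc: "x \<in> carrier G" using x by simp
    have cancel: "inv g \<otimes> ?h = x" using g xc by (simp add: m_assoc[symmetric])
    have "x \<noteq> \<one>" using len_basis[OF x] by auto
    then have ne: "g \<noteq> ?h" using cancel l_inv[OF g] by metis
    then have ne': "\<phi> g \<noteq> \<phi> ?h" using g xc inj_onD[OF \<phi>(2)] by blast
    have "len g \<le> len ?h + 1"
      using len_mult[of ?h "inv x"] g xc by (simp add: m_assoc len_inv len_basis[OF x])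
    then have 1: "real (len g) - 1 \<le> gromov_prod G A \<one> g ?h"
      using g xc cancel by (simp add: gromov_prod_def word_dist_eq_len len_basis[OF x])
    have "len (\<phi> ?h) \<le> len (\<phi> g) + len (inv (\<phi> g) \<otimes> \<phi> ?h)"
      using len_mult[of "\<phi> g" "inv (\<phi> g) \<otimes> \<phi> ?h"] g xc by (simp add: m_assoc[symmetric])
    then have 2: "gromov_prod G A \<one> (\<phi> g) (\<phi> ?h) \<le> len (\<phi> g)"
      using g xc by (simp add: gromov_prod_def word_dist_eq_len)
    have "exp (- gromov_prod G A \<one> (\<phi> g) (\<phi> ?h)) \<le> K * exp (- gromov_prod G A \<one> g ?h)"
      using le[of g ?h] g xc ne ne' by (simp add: visual_rho_def)
    also have "\<dots> = exp (ln K - gromov_prod G A \<one> g ?h)"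
      using K by (simp add: exp_diff exp_minus field_simps)
    finally have "gromov_prod G A \<one> g ?h \<le> ln K + gromov_prod G A \<one> (\<phi> g) (\<phi> ?h)" by simp
    then have "real (len g) \<le> len (\<phi> g) + (\<bar>ln K\<bar> + 1)" using 1 2 by linarith
    moreover have "\<bar>ln K\<bar> + 1 \<le> real (nat \<lceil>\<bar>ln K\<bar> + 1\<rceil>)" by (rule of_nat_ceiling)
    ultimately show ?thesis by linarith
  qed
  then show ?thesis by blast
qed

end

section \<open>Automorphisms\<close>

text \<open>Because \<open>N\<close> is normal, the product set is a subgroup, so it contains
  everything generated by \<open>N\<close> and \<open>S\<close>.\<close>

lemma (in group) generate_normal_Un:
  assumes N: "N \<lhd> G" and S: "S \<subseteq> carrier G"
  shows "generate G (N \<union> S) = N <#> generate G S"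
proof
  have sub: "subgroup (generate G S) G" by (rule generate_is_subgroup[OF S])
  have NS: "N \<union> S \<subseteq> carrier G" using S normal_imp_subgroup[OF N] subgroup.subset by blast
  interpret second_isomorphism_grp N G "generate G S"
    using N sub by (simp add: second_isomorphism_grp_def second_isomorphism_grp_axioms_def)
  show "generate G (N \<union> S) \<subseteq> N <#> generate G S"
  proof (rule generate_subgroup_incl[OF _ normal_set_mult_subgroup])
    have "S \<subseteq> generate G S" by (auto intro: generate.incl)
    then show "N \<union> S \<subseteq> N <#> generate G S"
      using H_contained_in_set_mult S_contained_in_set_mult by (meson Un_least subset_trans)
  qed
  show "N <#> generate G S \<subseteq> generate G (N \<union> S)"
    using mono_generate[of S "N \<union> S"]
    by (auto simp: set_mult_def intro!: generate.eng intro: generate.incl)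
qed

lemma (in group) generate_involution:
  assumes "x \<in> carrier G" "x \<otimes> x = \<one>"
  shows "generate G {x} = {\<one>, x}"
proof
  have inv: "inv x = x" using assms inv_equality by blast
  have "y = \<one> \<or> y = x" if "y \<in> generate G {x}" for y
    using that by (induction rule: generate.induct) (use assms inv in auto)
  then show "generate G {x} \<subseteq> {\<one>, x}" by blast
qed (auto intro: generate.one generate.incl)

lemma carrier_AutoGroup: "carrier (AutoGroup G) = auto G"
  and one_AutoGroup: "\<one>\<^bsub>AutoGroup G\<^esub> = (\<lambda>x\<in>carrier G. x)"
  and mult_AutoGroup: "f \<in> auto G \<Longrightarrow> g \<in> auto G \<Longrightarrow> f \<otimes>\<^bsub>AutoGroup G\<^esub> g = compose (carrier G) f g"
  by (auto simp: AutoGroup_def BijGroup_def auto_def)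

lemma autoD:
  assumes "f \<in> auto G"
  shows "f \<in> hom G G" "bij_betw f (carrier G) (carrier G)" "f \<in> extensional (carrier G)"
    "inj_on f (carrier G)"
  using assms by (auto simp: auto_def Bij_def bij_betw_def)

section \<open>Inner automorphisms\<close>

context group begin

lemma conj_cancel:
  assumes "r \<in> carrier G" "x \<in> carrier G"
  shows "inv r \<otimes> (r \<otimes> x \<otimes> inv r) \<otimes> r = x"
  using assms by (simp add: m_assoc) (simp add: m_assoc[symmetric])

definition inner :: "'a \<Rightarrow> 'a \<Rightarrow> 'a"
  where "inner g = (\<lambda>x\<in>carrier G. inv g \<otimes> x \<otimes> g)"

lemma inner_apply: "x \<in> carrier G \<Longrightarrow> inner g x = inv g \<otimes> x \<otimes> g"
  by (simp add: inner_def)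

lemma Inn_eq: "Inn G = inner ` carrier G"
  by (auto simp: Inn_def inner_def)

lemma inner_inner:
  "g \<in> carrier G \<Longrightarrow> h \<in> carrier G \<Longrightarrow> x \<in> carrier G \<Longrightarrow> inner g (inner h x) = inner (h \<otimes> g) x"
  by (simp add: inner_apply inv_mult_group m_assoc)

lemma inner_one: "x \<in> carrier G \<Longrightarrow> inner \<one> x = x"
  by (simp add: inner_apply)

lemma inner_auto: assumes "g \<in> carrier G" shows "inner g \<in> auto G"
proof -
  have "(\<lambda>x. inv g \<otimes> x \<otimes> inv (inv g)) \<in> hom G G"
    using assms by (intro conj_hom) (auto simp: hom_def)
  then have "inner g \<in> hom G G"
    by (rule hom_eq) (use assms in \<open>simp add: inner_apply\<close>)
  moreover have "bij_betw (inner g) (carrier G) (carrier G)"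
    by (rule bij_betw_byWitness[of _ "inner (inv g)"])
      (use assms in \<open>auto simp: inner_inner inner_one\<close>, use assms in \<open>auto simp: inner_apply\<close>)
  moreover have "inner g \<in> extensional (carrier G)" by (simp add: inner_def)
  ultimately show ?thesis by (simp add: auto_def Bij_def)
qed

text \<open>The order is reversed because \<open>inner g\<close> conjugates with
  \<open>inv g\<close> on the left, while composition applies the right factor first.\<close>

lemma inner_mult:
  assumes "g \<in> carrier G" "h \<in> carrier G"
  shows "inner g \<otimes>\<^bsub>AutoGroup G\<^esub> inner h = inner (h \<otimes> g)"
  unfolding mult_AutoGroup[OF inner_auto[OF assms(1)] inner_auto[OF assms(2)]]
proof (rule extensionalityI[OF compose_extensional])
  show "inner (h \<otimes> g) \<in> extensional (carrier G)" by (simp add: inner_def)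
qed (use assms in \<open>simp add: compose_def inner_inner\<close>)

text \<open>Conjugating \<open>inner g\<close> by an automorphism \<open>f\<close> gives
  \<open>inner (f g)\<close>.\<close>

lemma Inn_normal: "Inn G \<lhd> AutoGroup G"
proof -
  interpret Aut: group "AutoGroup G" by (rule AutoGroup)
  have one: "inner \<one> = \<one>\<^bsub>AutoGroup G\<^esub>"
    by (auto simp: one_AutoGroup inner_def restrict_def fun_eq_iff)
  have inv: "inv\<^bsub>AutoGroup G\<^esub> (inner g) = inner (inv g)" if "g \<in> carrier G" for g
    using that by (intro Aut.inv_equality) (simp_all add: inner_mult one carrier_AutoGroup inner_auto)
  have sub: "subgroup (Inn G) (AutoGroup G)"
  proof (rule Aut.subgroupI)
    show "Inn G \<subseteq> carrier (AutoGroup G)" by (auto simp: Inn_eq carrier_AutoGroup inner_auto)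
    show "Inn G \<noteq> {}" by (auto simp: Inn_eq)
  qed (auto simp: Inn_eq inv inner_mult)
  show ?thesis
  proof (rule Aut.normal_invI[OF sub])
    fix f k assume f: "f \<in> carrier (AutoGroup G)" and "k \<in> Inn G"
    then obtain g where g: "g \<in> carrier G" "k = inner g" by (auto simp: Inn_eq)
    have f': "f \<in> auto G" using f by (simp add: carrier_AutoGroup)
    interpret group_hom G G f
      using autoD[OF f'] is_group by (simp add: group_hom_def group_hom_axioms_def)
    have "f \<otimes>\<^bsub>AutoGroup G\<^esub> k = inner (f g) \<otimes>\<^bsub>AutoGroup G\<^esub> f"
      unfolding g(2) mult_AutoGroup[OF f' inner_auto[OF g(1)]]
        mult_AutoGroup[OF inner_auto[OF hom_closed[OF g(1)]] f']
      by (rule extensionalityI[OF compose_extensional compose_extensional])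
        (use g in \<open>simp add: compose_def inner_apply\<close>)
    then have "f \<otimes>\<^bsub>AutoGroup G\<^esub> k \<otimes>\<^bsub>AutoGroup G\<^esub> inv\<^bsub>AutoGroup G\<^esub> f = inner (f g)"
      using f inner_auto[OF hom_closed[OF g(1)], folded carrier_AutoGroup] by (simp add: Aut.m_assoc)
    then show "f \<otimes>\<^bsub>AutoGroup G\<^esub> k \<otimes>\<^bsub>AutoGroup G\<^esub> inv\<^bsub>AutoGroup G\<^esub> f \<in> Inn G"
      using g by (simp add: Inn_eq)
  qed
qed

end

section \<open>Automorphisms with controlled length distortion\<close>

context free_group begin

text \<open>The Nielsen move sending \<open>b\<close> to \<open>a \<otimes> b\<close> is inverted by
  the one sending \<open>b\<close> to \<open>inv a \<otimes> b\<close>, and bijective endomorphisms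
  carry bases to bases.\<close>

lemma mult_basis:
  assumes A: "A = {a, b}" "a \<noteq> b"
  shows "free_basis G {a, a \<otimes> b}"
proof -
  have ab: "a \<in> carrier G" "b \<in> carrier G" using A by auto
  define f where "f = extend G (\<lambda>x. if x = a then a else a \<otimes> b)"
  define g where "g = extend G (\<lambda>x. if x = a then a else inv a \<otimes> b)"
  have imgs: "(\<lambda>x. if x = a then a else a \<otimes> b) ` A \<subseteq> carrier G"
      "(\<lambda>x. if x = a then a else inv a \<otimes> b) ` A \<subseteq> carrier G"
    using ab by auto
  have mem: "a \<in> A" "b \<in> A" using A by auto
  have fh: "f \<in> hom G G" and gh: "g \<in> hom G G"
    unfolding f_def g_def by (intro extend_hom is_group imgs)+
  have f: "f a = a" "f b = a \<otimes> b" and g: "g a = a" "g b = inv a \<otimes> b"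
    using A(2) extend_basis[OF is_group imgs(1)] extend_basis[OF is_group imgs(2)] mem
    unfolding f_def g_def by metis+
  interpret F: group_hom G G f using fh is_group by (simp add: group_hom_def group_hom_axioms_def)
  interpret G: group_hom G G g using gh is_group by (simp add: group_hom_def group_hom_axioms_def)
  have id: "(\<lambda>x. x) \<in> hom G G" by (simp add: hom_def)
  have gf: "g (f x) = x" if "x \<in> carrier G" for x
    by (rule hom_eqI[OF is_group _ id _ that, of "\<lambda>x. g (f x)"])
      (use A ab f g in \<open>auto simp: hom_def m_assoc[symmetric]\<close>)
  have fg: "f (g x) = x" if "x \<in> carrier G" for x
    by (rule hom_eqI[OF is_group _ id _ that, of "\<lambda>x. f (g x)"])
      (use A ab f g in \<open>auto simp: hom_def m_assoc[symmetric]\<close>)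
  have "bij_betw f (carrier G) (carrier G)"
    by (rule bij_betw_byWitness[of _ g]) (use gf fg in auto)
  from free_basis_bij_image[OF basis fh this] show ?thesis using A(1) f by simp
qed

text \<open>The powers of \<open>\<psi> u\<close> are images of powers of \<open>u\<close> and have
  length at most \<open>n + C\<close>. So \<open>\<psi> u\<close> has cyclic length at most
  \<open>1\<close>, and injectivity excludes \<open>0\<close>.\<close>

lemma conj_letter_of_contraction:
  assumes \<psi>: "\<psi> \<in> hom G G" "inj_on \<psi> (carrier G)" and C: "\<And>g. g \<in> carrier G \<Longrightarrow> len (\<psi> g) \<le> len g + C"
    and u: "u \<in> A"
  obtains p l where "p \<in> carrier G" "fst l \<in> A" "\<psi> u = p \<otimes> letter_val G l \<otimes> inv p"
proof -
  interpret P: group_hom G G \<psi> using \<psi> is_group by (simp add: group_hom_def group_hom_axioms_def)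
  have uc: "u \<in> carrier G" "\<psi> u \<in> carrier G" using u by auto
  obtain c h where c: "c \<in> carrier G" "h \<in> carrier G" "\<psi> u = h \<otimes> c \<otimes> inv h" "cyc_reduced (nf c)"
    using exists_cyc_reduced_conj[OF uc(2)] .
  have "len (\<psi> u [^] n) \<le> 1 * n + C" for n :: nat
  proof -
    have "len (u [^] n) \<le> n"
      using pow_bound_of_conj[OF uc(1) one_closed, of n] uc by (simp add: len_basis[OF u])
    then show ?thesis using C[of "u [^] n"] uc by (simp add: P.hom_nat_pow)
  qed
  then have "len c \<le> 1" using len_le_of_pow_bound[OF c(1,2,4)] c(3) by metis
  moreover have "c \<noteq> \<one>"
  proof
    assume "c = \<one>"
    then have "\<psi> u = \<psi> \<one>" using c by simp
    then have "u = \<one>" using \<psi>(2) uc inj_onD by fastforce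
    then show False using len_basis[OF u] by simp
  qed
  ultimately show ?thesis using letter_of_len_le_one[OF c(1)] c that by metis
qed

text \<open>The basis \<open>{a, b}\<close> alone would also permit swapping the generators or
  inverting only one of them. The basis \<open>{a, a \<otimes> b}\<close> rules this out through
  exponent sums.\<close>

lemma contraction_conj:
  assumes A: "A = {a, b}" "a \<noteq> b" and \<psi>: "\<psi> \<in> hom G G" "inj_on \<psi> (carrier G)"
    and contr: "\<And>B. free_basis G B \<Longrightarrow> \<exists>C. \<forall>g\<in>carrier G. free_group.len G B (\<psi> g) \<le> free_group.len G B g + C"
  shows "\<exists>s. \<exists>r\<in>carrier G. \<forall>g\<in>carrier G. \<psi> g = r \<otimes> (if s then g else flip g) \<otimes> inv r"
proof -
  have ab: "a \<in> carrier G" "b \<in> carrier G" "a \<in> A" "b \<in> A" using A by auto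
  have e: "expo a a = 1" "expo a b = 0" "expo b a = 0" "expo b b = 1"
    using A(2) ab by (simp_all add: expo_basis)
  have bB: "free_basis G {a, a \<otimes> b}" by (rule mult_basis[OF A])
  interpret B: free_group G "{a, a \<otimes> b}" using bB by unfold_locales
  interpret P: group_hom G G \<psi> using \<psi> is_group by (simp add: group_hom_def group_hom_axioms_def)
  obtain C where C: "\<And>g. g \<in> carrier G \<Longrightarrow> len (\<psi> g) \<le> len g + C"
    using contr[OF basis] by blast
  obtain C' where C': "\<And>g. g \<in> carrier G \<Longrightarrow> B.len (\<psi> g) \<le> B.len g + C'"
    using contr[OF bB] by blast
  have eA: "fst l = a \<and> expo a (\<psi> u) = (if snd l then 1 else - 1) \<and> expo b (\<psi> u) = 0 \<or>
      fst l = b \<and> expo a (\<psi> u) = 0 \<and> expo b (\<psi> u) = (if snd l then 1 else - 1)"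
    if l: "p \<in> carrier G" "fst l \<in> A" "\<psi> u = p \<otimes> letter_val G l \<otimes> inv p" for p l u
  proof -
    have "expo x (\<psi> u) = (if fst l = x then if snd l then 1 else - 1 else 0)" for x
      using l by (simp add: expo_conj letter_val_closed expo_letter_val)
    moreover have "fst l = a \<or> fst l = b" using l(2) A(1) by blast
    ultimately show ?thesis using A(2) by auto
  qed
  \<comment> \<open>Conjugates of letters over the second basis have exponent vectors
    \<open>(1, 0)\<close> or \<open>(1, 1)\<close> up to sign.\<close>
  have eB: "\<exists>s. expo a (\<psi> u) = (if s then 1 else - 1) \<and> (expo b (\<psi> u) = 0 \<or> expo b (\<psi> u) = (if s then 1 else - 1))"
    if u: "u \<in> {a, a \<otimes> b}" for u
  proof -
    obtain p l where pl: "p \<in> carrier G" "fst l \<in> {a, a \<otimes> b}" "\<psi> u = p \<otimes> letter_val G l \<otimes> inv p"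
      using B.conj_letter_of_contraction[OF \<psi> C' u] .
    have "fst l \<in> carrier G" using pl(2) ab by auto
    then have "expo x (\<psi> u) = (if snd l then 1 else - 1) * expo x (fst l)" for x
      using pl by (simp add: expo_conj letter_val_def expo_inv)
    moreover have "expo a (fst l) = 1" "expo b (fst l) = 0 \<or> expo b (fst l) = 1"
      using pl(2) ab e by (auto simp: expo_mult)
    ultimately show ?thesis by (intro exI[of _ "snd l"]) auto
  qed
  obtain p l where l: "p \<in> carrier G" "fst l \<in> A" "\<psi> a = p \<otimes> letter_val G l \<otimes> inv p"
    using conj_letter_of_contraction[OF \<psi> C ab(3)] .
  obtain q m where m: "q \<in> carrier G" "fst m \<in> A" "\<psi> b = q \<otimes> letter_val G m \<otimes> inv q"
    using conj_letter_of_contraction[OF \<psi> C ab(4)] .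
  have sum: "expo x (\<psi> (a \<otimes> b)) = expo x (\<psi> a) + expo x (\<psi> b)" for x
    using ab by (simp add: expo_mult)
  obtain s where s: "expo a (\<psi> a) = (if s then 1 else - 1)"
    using eB[of a] by blast
  obtain s' where s': "expo a (\<psi> a) + expo a (\<psi> b) = (if s' then 1 else - 1)"
      "expo b (\<psi> a) + expo b (\<psi> b) = 0 \<or> expo b (\<psi> a) + expo b (\<psi> b) = (if s' then 1 else - 1)"
    using eB[of "a \<otimes> b"] unfolding sum by blast
  have la: "fst l = a" "expo a (\<psi> a) = (if snd l then 1 else - 1)" "expo b (\<psi> a) = 0"
    using eA[OF l] s by (cases s; simp)+
  \<comment> \<open>If \<open>m\<close> were over \<open>a\<close>, the image of
    \<open>a \<otimes> b\<close> would have an even exponent sum in \<open>a\<close>. With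
    \<open>m\<close> over \<open>b\<close>, the two exponents of that image must have equal
    sign.\<close>
  have "fst m = b \<and> snd m = snd l"
    using eA[OF m] s' la(2,3) by (cases "snd l"; cases "snd m"; cases s') auto
  then have "m = (b, snd l)" by (simp add: prod_eq_iff)
  moreover have "l = (a, snd l)" using la(1) by (simp add: prod_eq_iff)
  ultimately obtain s where lm: "l = (a, s)" "m = (b, s)" by metis
  \<comment> \<open>The image of \<open>a \<otimes> b\<close> has cyclic length at most
    \<open>2\<close>, which is what forces a common conjugator.\<close>
  have "len (\<psi> (a \<otimes> b) [^] n) \<le> 2 * n + C" for n :: nat
  proof -
    have "len (a \<otimes> b) \<le> 2" using len_mult[OF ab(1,2)] ab by (simp add: len_basis)
    then have "len (a \<otimes> b) * n \<le> 2 * n" by (rule mult_le_mono1)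
    moreover have "len ((a \<otimes> b) [^] n) \<le> len (a \<otimes> b) * n"
      using pow_bound_of_conj[OF _ one_closed, of "a \<otimes> b" n] ab by simp
    moreover have "len (\<psi> (a \<otimes> b) [^] n) \<le> len ((a \<otimes> b) [^] n) + C"
      using C[of "(a \<otimes> b) [^] n"] ab P.hom_nat_pow[of "a \<otimes> b" n] by simp
    ultimately show ?thesis by linarith
  qed
  from hom_conj_of_letters[OF A \<psi>(1) l(1) l(3)[unfolded lm] m(1) m(3)[unfolded lm] this]
  show ?thesis by blast
qed

text \<open>Up to an inner automorphism \<open>flip\<close> is the flip of \<open>B\<close>, which
  preserves length over \<open>B\<close>; conjugation by a fixed element changes lengths by a
  bounded amount.\<close>

lemma conj_flip_rough:
  assumes A: "A = {a, b}" "a \<noteq> b" and r: "r \<in> carrier G" and B: "free_basis G B"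
    and \<phi>: "\<And>g. g \<in> carrier G \<Longrightarrow> \<phi> g = inv r \<otimes> (if s then g else flip g) \<otimes> r"
  shows "\<exists>C. \<forall>g\<in>carrier G. free_group.len G B (\<phi> g) \<le> free_group.len G B g + C \<and>
    free_group.len G B g \<le> free_group.len G B (\<phi> g) + C"
proof -
  interpret B: free_group G B using B by unfold_locales
  obtain k where k: "k \<in> carrier G" "\<And>g. g \<in> carrier G \<Longrightarrow> B.flip g = k \<otimes> flip g \<otimes> inv k"
    using flip_inner[OF A B] by blast
  have flip: "flip g = inv k \<otimes> B.flip g \<otimes> k" if "g \<in> carrier G" for g
    using k that conj_cancel[OF k(1) flip_closed[OF that]] by simp
  \<comment> \<open>Collects the conjugation by \<open>r\<close> and, in the flip case, the passage
    from \<open>flip\<close> to \<open>B.flip\<close>.\<close>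
  define z where "z = (if s then inv r else inv r \<otimes> inv k)"
  define \<tau> where "\<tau> = (\<lambda>g. if s then g else B.flip g)"
  have z: "z \<in> carrier G" using r k by (simp add: z_def)
  have \<tau>: "\<tau> g \<in> carrier G" "B.len (\<tau> g) = B.len g" if "g \<in> carrier G" for g
    using that by (simp_all add: \<tau>_def B.flip_closed B.len_flip)
  have eq: "\<phi> g = z \<otimes> \<tau> g \<otimes> inv z" if "g \<in> carrier G" for g
    using that r k flip B.flip_closed by (simp add: \<phi> z_def \<tau>_def inv_mult_group m_assoc)
  have eq': "\<tau> g = inv z \<otimes> \<phi> g \<otimes> inv (inv z)" if "g \<in> carrier G" for g
    unfolding eq[OF that] using conj_cancel[OF z \<tau>(1)[OF that]] z by simp
  have "\<phi> g \<in> carrier G" if "g \<in> carrier G" for g using \<tau> z that by (simp add: eq)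
  then have "B.len (\<phi> g) \<le> B.len g + 2 * B.len z" "B.len g \<le> B.len (\<phi> g) + 2 * B.len z"
    if "g \<in> carrier G" for g
    using B.len_conj[OF \<tau>(1)[OF that] z, folded eq[OF that]] B.len_conj[of "\<phi> g" "inv z", folded eq'[OF that]]
      \<tau>(2)[OF that] z that by (simp_all add: B.len_inv)
  then show ?thesis by blast
qed

end

theorem proposition6p7:
  fixes F2 :: "('a, 'm) monoid_scheme"
    and a b :: 'a
    and \<epsilon> \<phi> :: "'a \<Rightarrow> 'a"
  assumes "group F2"
    and "a \<noteq> b" and "free_basis F2 {a, b}"
    and "\<epsilon> \<in> auto F2" and "\<epsilon> a = inv\<^bsub>F2\<^esub> a" and "\<epsilon> b = inv\<^bsub>F2\<^esub> b"
    and "\<phi> \<in> auto F2"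
  shows "((\<forall>A' p' \<gamma>' T d.
             free_basis F2 A' \<and> p' \<in> carrier F2 \<and> \<gamma>' > 0 \<and> T \<ge> 1 \<and>
             d \<in> visual_metrics F2 A' p' \<gamma>' T \<longrightarrow> lipschitz_condition (carrier F2) d \<phi>)
          \<longleftrightarrow> \<phi> \<in> generate (AutoGroup F2) (Inn F2 \<union> {\<epsilon>}))
         \<and> generate (AutoGroup F2) (Inn F2 \<union> {\<epsilon>})
             = Inn F2 <#>\<^bsub>AutoGroup F2\<^esub> generate (AutoGroup F2) {\<epsilon>}"
proof -
  interpret group F2 by fact
  interpret free_group F2 "{a, b}" using assms(3) by unfold_locales
  interpret Aut: group "AutoGroup F2" by (rule AutoGroup)
  have \<phi>: "\<phi> \<in> hom F2 F2" "bij_betw \<phi> (carrier F2) (carrier F2)" "\<phi> \<in> extensional (carrier F2)"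
    "inj_on \<phi> (carrier F2)"
    by (fact autoD[OF assms(7)])+
  \<comment> \<open>Equality holds on the carrier, by agreement on the basis; elsewhere
    \<open>\<epsilon>\<close> is \<open>undefined\<close>.\<close>
  have \<epsilon>: "\<epsilon> g = flip g" if "g \<in> carrier F2" for g
    by (rule hom_eqI[OF is_group autoD(1)[OF assms(4)] flip_hom _ that])
      (use assms(5,6) flip_basis in auto)
  have prod: "generate (AutoGroup F2) (Inn F2 \<union> {\<epsilon>}) =
      Inn F2 <#>\<^bsub>AutoGroup F2\<^esub> generate (AutoGroup F2) {\<epsilon>}"
    using assms(4) by (intro Aut.generate_normal_Un Inn_normal) (simp add: carrier_AutoGroup)
  have "\<epsilon> \<otimes>\<^bsub>AutoGroup F2\<^esub> \<epsilon> = \<one>\<^bsub>AutoGroup F2\<^esub>"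
    using assms(4) by (auto simp: mult_AutoGroup one_AutoGroup compose_def restrict_def fun_eq_iff \<epsilon> flip_closed flip_flip)
  then have gen: "generate (AutoGroup F2) {\<epsilon>} = {\<one>\<^bsub>AutoGroup F2\<^esub>, \<epsilon>}"
    using assms(4) by (intro Aut.generate_involution) (simp_all add: carrier_AutoGroup)
  have mem_iff: "\<phi> \<in> generate (AutoGroup F2) (Inn F2 \<union> {\<epsilon>}) \<longleftrightarrow>
      (\<exists>s. \<exists>r\<in>carrier F2. \<forall>g\<in>carrier F2. \<phi> g = inv\<^bsub>F2\<^esub> r \<otimes>\<^bsub>F2\<^esub> (if s then g else flip g) \<otimes>\<^bsub>F2\<^esub> r)"
    (is "_ \<longleftrightarrow> ?conj")
  proof -
    \<comment> \<open>The two elements of the subgroup generated by \<open>\<epsilon>\<close>,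
      indexed by the sign \<open>s\<close>.\<close>
    define \<sigma> where "\<sigma> = (\<lambda>s. if s then \<one>\<^bsub>AutoGroup F2\<^esub> else \<epsilon>)"
    have \<sigma>: "\<sigma> s \<in> auto F2" for s
      using assms(4) Aut.one_closed by (auto simp: \<sigma>_def carrier_AutoGroup)
    have "\<phi> = inner r \<otimes>\<^bsub>AutoGroup F2\<^esub> \<sigma> s \<longleftrightarrow>
        (\<forall>g\<in>carrier F2. \<phi> g = inv\<^bsub>F2\<^esub> r \<otimes>\<^bsub>F2\<^esub> (if s then g else flip g) \<otimes>\<^bsub>F2\<^esub> r)"
      if r: "r \<in> carrier F2" for r s
    proof -
      have "(inner r \<otimes>\<^bsub>AutoGroup F2\<^esub> \<sigma> s) g = inv\<^bsub>F2\<^esub> r \<otimes>\<^bsub>F2\<^esub> (if s then g else flip g) \<otimes>\<^bsub>F2\<^esub> r"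
        if "g \<in> carrier F2" for g
        unfolding mult_AutoGroup[OF inner_auto[OF r] \<sigma>]
        using that by (simp add: compose_def \<sigma>_def one_AutoGroup \<epsilon> inner_apply flip_closed)
      moreover have "inner r \<otimes>\<^bsub>AutoGroup F2\<^esub> \<sigma> s \<in> extensional (carrier F2)"
        unfolding mult_AutoGroup[OF inner_auto[OF r] \<sigma>] by (rule compose_extensional)
      ultimately show ?thesis using extensionalityI[OF \<phi>(3)] by metis
    qed
    moreover have "\<phi> \<in> Inn F2 <#>\<^bsub>AutoGroup F2\<^esub> {\<one>\<^bsub>AutoGroup F2\<^esub>, \<epsilon>} \<longleftrightarrow>
        (\<exists>s. \<exists>r\<in>carrier F2. \<phi> = inner r \<otimes>\<^bsub>AutoGroup F2\<^esub> \<sigma> s)"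
      by (auto simp: set_mult_def Inn_eq \<sigma>_def split: if_splits)
    ultimately show ?thesis unfolding prod gen by simp
  qed
  have "\<phi> \<in> generate (AutoGroup F2) (Inn F2 \<union> {\<epsilon>})"
    if lip: "\<forall>A' p' \<gamma>' T d. free_basis F2 A' \<and> p' \<in> carrier F2 \<and> \<gamma>' > 0 \<and> T \<ge> 1 \<and>
      d \<in> visual_metrics F2 A' p' \<gamma>' T \<longrightarrow> lipschitz_condition (carrier F2) d \<phi>"
  proof -
    define \<psi> where "\<psi> = inv_into (carrier F2) \<phi>"
    have \<psi>_bij: "bij_betw \<psi> (carrier F2) (carrier F2)"
      unfolding \<psi>_def by (rule bij_betw_inv_into[OF \<phi>(2)])
    have \<psi>\<phi>: "\<psi> (\<phi> g) = g" and \<phi>\<psi>: "\<phi> (\<psi> g) = g" and \<psi>_closed: "\<psi> g \<in> carrier F2" if "g \<in> carrier F2" for g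
      using that \<phi>(2) bij_betw_apply[OF \<psi>_bij]
      by (simp_all add: \<psi>_def bij_betw_inv_into_left bij_betw_inv_into_right)
    have "restrict \<psi> (carrier F2) \<in> hom F2 F2"
      unfolding \<psi>_def using assms(7) by (intro restrict_inv_into_hom) (auto simp: auto_def)
    then have \<psi>_hom: "\<psi> \<in> hom F2 F2" by (rule hom_eq) simp
    have contr: "\<exists>C. \<forall>g\<in>carrier F2. free_group.len F2 B (\<psi> g) \<le> free_group.len F2 B g + C"
      if B: "free_basis F2 B" for B
    proof -
      interpret B: free_group F2 B using B by unfold_locales
      obtain x y where "B = {x, y}" using rank_two[OF refl assms(2) B] by metis
      then have "x \<in> B" by simp
      \<comment> \<open>Of all visual metrics for \<open>B\<close> only the ultrametric one at
        \<open>\<one>\<close> with exponent \<open>1\<close> is tested.\<close>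
      moreover have "lipschitz_condition (carrier F2) (\<lambda>g h. if g \<in> carrier F2 \<and> h \<in> carrier F2
          then visual_rho F2 B \<one>\<^bsub>F2\<^esub> 1 g h else 0) \<phi>"
        by (rule lip[rule_format, where A' = B and p' = "\<one>\<^bsub>F2\<^esub>" and \<gamma>' = 1 and T = 1])
          (use B B.visual_rho_visual_metric[of 1] in simp)
      ultimately obtain C where "\<And>g. g \<in> carrier F2 \<Longrightarrow> B.len g \<le> B.len (\<phi> g) + C"
        using B.len_le_of_lipschitz[OF \<phi>(1,4)] by blast
      \<comment> \<open>Inserting \<open>\<psi> g\<close> for \<open>g\<close> turns the lower bound
        on lengths under \<open>\<phi>\<close> into an upper bound for
        \<open>\<psi>\<close>.\<close>
      then show ?thesis using \<psi>_closed \<phi>\<psi> by metis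
    qed
    obtain s r where r: "r \<in> carrier F2"
      "\<And>g. g \<in> carrier F2 \<Longrightarrow> \<psi> g = r \<otimes>\<^bsub>F2\<^esub> (if s then g else flip g) \<otimes>\<^bsub>F2\<^esub> inv\<^bsub>F2\<^esub> r"
      using contraction_conj[OF refl assms(2) \<psi>_hom bij_betw_imp_inj_on[OF \<psi>_bij] contr] by blast
    define \<sigma> where "\<sigma> = (\<lambda>g. if s then g else flip g)"
    have \<sigma>: "\<sigma> (\<sigma> g) = g" "\<sigma> g \<in> carrier F2" if "g \<in> carrier F2" for g
      using that by (simp_all add: \<sigma>_def flip_flip flip_closed)
    have "\<sigma> \<in> hom F2 F2" using flip_hom by (cases s) (auto simp: hom_def \<sigma>_def)
    then interpret S: group_hom F2 F2 \<sigma> using is_group by (simp add: group_hom_def group_hom_axioms_def)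
    \<comment> \<open>The formula for \<open>\<psi>\<close> is solved for \<open>\<phi> g\<close> by
      applying the involutive homomorphism \<open>\<sigma>\<close>; the conjugator becomes
      \<open>\<sigma> r\<close>.\<close>
    have "\<phi> g = inv\<^bsub>F2\<^esub> (\<sigma> r) \<otimes>\<^bsub>F2\<^esub> \<sigma> g \<otimes>\<^bsub>F2\<^esub> \<sigma> r" if g: "g \<in> carrier F2" for g
    proof -
      have \<phi>g: "\<phi> g \<in> carrier F2" using hom_in_carrier[OF \<phi>(1) g] .
      have "g = r \<otimes>\<^bsub>F2\<^esub> \<sigma> (\<phi> g) \<otimes>\<^bsub>F2\<^esub> inv\<^bsub>F2\<^esub> r" using r(2)[OF \<phi>g] \<psi>\<phi>[OF g] by (simp add: \<sigma>_def)
      then have "\<sigma> g = \<sigma> (r \<otimes>\<^bsub>F2\<^esub> \<sigma> (\<phi> g) \<otimes>\<^bsub>F2\<^esub> inv\<^bsub>F2\<^esub> r)" by simp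
      also have "\<dots> = \<sigma> r \<otimes>\<^bsub>F2\<^esub> \<phi> g \<otimes>\<^bsub>F2\<^esub> inv\<^bsub>F2\<^esub> (\<sigma> r)"
        using r(1) \<sigma>[OF \<phi>g] by simp
      finally show ?thesis
        using conj_cancel[OF \<sigma>(2)[OF r(1)] \<phi>g] by simp
    qed
    then show ?thesis unfolding mem_iff \<sigma>_def using \<sigma>(2)[OF r(1), unfolded \<sigma>_def] by blast
  qed
  moreover have "lipschitz_condition (carrier F2) d \<phi>"
    if "\<phi> \<in> generate (AutoGroup F2) (Inn F2 \<union> {\<epsilon>})" and B: "free_basis F2 B" "p \<in> carrier F2" "\<gamma> > 0" "T \<ge> 1"
      "d \<in> visual_metrics F2 B p \<gamma> T" for B p \<gamma> T d
  proof -
    interpret B: free_group F2 B using B by unfold_locales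
    from that(1)[unfolded mem_iff] obtain s r where r: "r \<in> carrier F2"
      "\<forall>g\<in>carrier F2. \<phi> g = inv\<^bsub>F2\<^esub> r \<otimes>\<^bsub>F2\<^esub> (if s then g else flip g) \<otimes>\<^bsub>F2\<^esub> r"
      by (elim exE bexE)
    have "\<exists>C. \<forall>g\<in>carrier F2. B.len (\<phi> g) \<le> B.len g + C \<and> B.len g \<le> B.len (\<phi> g) + C"
      by (rule conj_flip_rough[OF refl assms(2) r(1) B(1) r(2)[rule_format]])
    then obtain C where "\<forall>g\<in>carrier F2. B.len (\<phi> g) \<le> B.len g + C \<and> B.len g \<le> B.len (\<phi> g) + C" ..
    then show ?thesis by (intro B.lipschitz_of_rough_isometry[OF \<phi>(1,4) _ _ B(2-5)]) auto
  qed
  ultimately show ?thesis using prod by blast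
qed

end
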